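(* Let $\mathcal H$ be a separable reproducing kernel Hilbert space of functions $\mathcal X\to\mathbb R$ with reproducing kernel $K$, write $K_x=K(x,\cdot)$, and let $(S_n)_{n\ge1}$ be a sequence of bounded linear test-statistics (random elements of $\mathcal H^\star$). Suppose: ($G_0$) there is a continuous symmetric bilinear form $\sigma:\mathcal H\times\mathcal H\to\mathbb R$ such that for every $m\in\mathbb N$ and all $\omega_1,\dots,\omega_m\in\mathcal H$, $S_n(\omega_1+\dots+\omega_m)$ converges in distribution as $n\to\infty$ to a normal random variable with mean $0$ and variance $\sum_{i=1}^m\sum_{j=1}^m\sigma(\omega_i,\omega_j)$; ($G_1$) for some orthonormal basis $(\psi_i)_{i\ge1}$ of $\mathcal H$, $\sum_{i\ge1}\sigma(\psi_i,\psi_i)<\infty$; ($G_2$) for some orthonormal basis $(\psi_i)_{i\ge1}$ of $\mathcal H$ and every $\varepsilon>0$, $\lim_{i\to\infty}\limsup_{n\to\infty}\mathbb P\big(\|S_n\circ P_{V_i^\perp}\|_{\mathcal H\to\mathbb R}^2\ge\varepsilon\big)=0$, where $V_i=\mathrm{span}(\psi_1,\dots,\psi_i)$ and $P_{V_i^\perp}$ is the orthogonal projection onto $V_i^\perp$. Let $T_\sigma:\mathcal H\to\mathcal H$ be the operator $(T_\sigma\omega)(x)=\sigma(\omega,K_x)$, $x\in\mathcal X$, and let $(\lambda_i,\phi_i)_{i\ge1}$ be its eigenvalues and corresponding eigenvectors, with $(\phi_i)_{i\ge1}$ an orthonormal basis of $\mathcal H$. Let $(Z_i)_{i\ge1}$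 be i.i.d. standard normal random variables and define $$S(\cdot)=\sum_{i=1}^\infty\sqrt{\lambda_i}\,\langle\phi_i,\cdot\rangle_{\mathcal H}Z_i .$$ Then the sum defining $S$ converges almost surely in $\mathcal H^\star$, and, as $n\to\infty$, $$S_n\overset{\mathcal D}{\to}S\quad\text{(in }\mathcal H^\star\text{)}\qquad\text{and}\qquad \Psi_n=\|S_n\|_{\mathcal H\to\mathbb R}^2\overset{\mathcal D}{\to}\sum_{i=1}^\infty\lambda_iZ_i^2 .$$
   Context: $\mathcal H^\star$ is the space of bounded linear functionals on $\mathcal H$ with operator norm $\|\cdot\|_{\mathcal H\to\mathbb R}$. A bounded linear test-statistic is a random variable taking values in $\mathcal H^\star$ (measurable for the Borel $\sigma$-algebra) defined on an underlying probability space. $\Psi_n:=\|S_n\|_{\mathcal H\to\mathbb R}^2=\sup_{\omega\in\mathcal H:\|\omega\|_{\mathcal H}=1}S_n(\omega)^2$. $\overset{\mathcal D}{\to}$ denotes convergence in distribution (weak convergence of laws, on $\mathcal H^\star$ with its norm topology, respectively on $\mathbb R$). If $\mathcal H$ is finite-dimensional, bases and sums are finite. Under the hypotheses $T_\sigma$ maps $\mathcal H$ into $\mathcal H$ and is self-adjoint, non-negative and trace class, so such an orthonormal eigenbasis exists. *)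

theory Defs
  imports "HOL-Probability.Probability"
begin

text \<open>
  A reproducing kernel Hilbert space of functions on \<open>'x\<close> is given by a Hilbert space type \<open>'h\<close>
  together with an injective linear map \<open>app\<close> sending \<open>\<omega> :: 'h\<close> to the function
  \<open>app \<omega> :: 'x \<Rightarrow> real\<close> that it stands for, so that the space of functions is \<open>range app\<close> with the
  Hilbert space structure of \<open>'h\<close>. The element \<open>kernel_at app K x\<close> is the one that stands for the
  function \<open>K x\<close>.
\<close>

definition kernel_at :: "('h \<Rightarrow> 'x \<Rightarrow> real) \<Rightarrow> ('x \<Rightarrow> 'x \<Rightarrow> real) \<Rightarrow> 'x \<Rightarrow> 'h" where
  "kernel_at app K x = inv app (K x)"

definition rkhs ::
  "('h::{real_inner, complete_space} \<Rightarrow> 'x \<Rightarrow> real) \<Rightarrow> ('x \<Rightarrow> 'x \<Rightarrow> real) \<Rightarrow> bool" where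
  "rkhs app K \<longleftrightarrow>
     inj app \<and> (\<forall>x. linear (\<lambda>\<omega>. app \<omega> x)) \<and>
     (\<forall>x. K x \<in> range app) \<and>
     (\<forall>x \<omega>. app \<omega> x = \<omega> \<bullet> kernel_at app K x)"

text \<open>
  Orthonormal bases are indexed by an initial segment \<open>I\<close> of the natural numbers, which is finite
  exactly when the space is finite-dimensional; indices start at \<open>0\<close>, so \<open>\<psi> i\<close> is the
  \<open>(i + 1)\<close>-st basis vector. Series over the basis are series over all natural numbers whose
  terms outside \<open>I\<close> are \<open>0\<close>.
\<close>

definition orthonormal_basis :: "nat set \<Rightarrow> (nat \<Rightarrow> 'h::real_inner) \<Rightarrow> bool" where
  "orthonormal_basis I \<psi> \<longleftrightarrow>
     (I = UNIV \<or> (\<exists>d. I = {..<d})) \<and>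
     (\<forall>i\<in>I. \<forall>j\<in>I. \<psi> i \<bullet> \<psi> j = (if i = j then 1 else 0)) \<and>
     closure (span (\<psi> ` I)) = UNIV"

text \<open>
  The orthogonal projection is well defined for closed subspaces of a Hilbert space.
\<close>

definition orthogonal_projection :: "'h::real_inner set \<Rightarrow> 'h \<Rightarrow> 'h" where
  "orthogonal_projection W x = (THE y. y \<in> W \<and> (\<forall>w\<in>W. orthogonal (x - y) w))"

text \<open>
  The law of \<open>\<mu> + sqrt v * N\<close> with \<open>N\<close> standard normal, which is the Dirac law at \<open>\<mu>\<close> for
  \<open>v = 0\<close>; only meaningful for \<open>v \<ge> 0\<close>.
\<close>

definition normal_law :: "real \<Rightarrow> real \<Rightarrow> real measure" where
  "normal_law \<mu> v = distr std_normal_distribution borel (\<lambda>x. \<mu> + sqrt v * x)"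

text \<open>
  The library's \<^const>\<open>weak_conv_m\<close> is restricted to laws on the real line, where it agrees with
  the following notion (see \<open>weakly_converges_iff_weak_conv_m\<close>).
\<close>

definition weakly_converges :: "(nat \<Rightarrow> 'a::topological_space measure) \<Rightarrow> 'a measure \<Rightarrow> bool" where
  "weakly_converges L L' \<longleftrightarrow>
     (\<forall>f :: 'a \<Rightarrow> real. continuous_on UNIV f \<and> bounded (range f) \<longrightarrow>
        (\<lambda>n. integral\<^sup>L (L n) f) \<longlonglongrightarrow> integral\<^sup>L L' f)"

definition limit_term ::
  "nat set \<Rightarrow> (nat \<Rightarrow> real) \<Rightarrow> (nat \<Rightarrow> 'h) \<Rightarrow> (nat \<Rightarrow> real) \<Rightarrow> nat \<Rightarrow> 'h::real_inner \<Rightarrow>\<^sub>L real" where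
  "limit_term I l \<phi> z i =
     (if i \<in> I then (sqrt (l i) * z i) *\<^sub>R blinfun_inner_right (\<phi> i) else 0)"

lemma normal_law_0: "normal_law \<mu> 0 = return borel \<mu>"
proof -
  interpret N: real_distribution std_normal_distribution
    by (rule real_dist_normal_dist)
  show ?thesis
    unfolding normal_law_def by (simp add: N.distr_const)
qed

lemma normal_law_pos:
  assumes "0 < v"
  shows "normal_law \<mu> v = density lborel (normal_density \<mu> (sqrt v))"
proof -
  interpret N: real_distribution std_normal_distribution
    by (rule real_dist_normal_dist)
  have "distr std_normal_distribution lborel (\<lambda>x. x) = std_normal_distribution"
    by (rule distr_id2) simp
  then have "distributed std_normal_distribution lborel (\<lambda>x. x) std_normal_density"
    by (simp add: distributed_def)
  from N.normal_density_affine[OF this, of "sqrt v" \<mu>] assms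
  have "distr std_normal_distribution lborel (\<lambda>x. \<mu> + sqrt v * x)
      = density lborel (normal_density \<mu> (sqrt v))"
    by (simp add: distributed_def)
  moreover have "distr std_normal_distribution lborel (\<lambda>x. \<mu> + sqrt v * x)
      = distr std_normal_distribution borel (\<lambda>x. \<mu> + sqrt v * x)"
    by (rule distr_cong) simp_all
  ultimately show ?thesis
    by (simp add: normal_law_def)
qed

lemma weakly_converges_iff_weak_conv_m:
  assumes L: "\<And>n. real_distribution (L n)" and L': "real_distribution L'"
  shows "weakly_converges L L' \<longleftrightarrow> weak_conv_m L L'"
proof
  assume w: "weakly_converges L L'"
  show "weak_conv_m L L'"
  proof (rule integral_bdd_continuous_conv_imp_weak_conv[OF L L'])
    fix f :: "real \<Rightarrow> real"
    assume "\<And>x. isCont f x" and "\<And>x. \<bar>f x\<bar> \<le> 1"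
    then have "continuous_on UNIV f \<and> bounded (range f)"
      by (auto simp: bounded_iff intro!: continuous_at_imp_continuous_on)
    with w show "(\<lambda>n. integral\<^sup>L (L n) f) \<longlonglongrightarrow> integral\<^sup>L L' f"
      unfolding weakly_converges_def by blast
  qed
next
  assume w: "weak_conv_m L L'"
  show "weakly_converges L L'"
    unfolding weakly_converges_def
  proof (intro allI impI, elim conjE)
    fix f :: "real \<Rightarrow> real"
    assume "continuous_on UNIV f" "bounded (range f)"
    then have "\<And>x. isCont f x" and "\<exists>B. \<forall>x. norm (f x) \<le> B"
      by (auto simp: continuous_on_eq_continuous_at bounded_iff)
    then show "(\<lambda>n. integral\<^sup>L (L n) f) \<longlonglongrightarrow> integral\<^sup>L L' f"
      using weak_conv_imp_integral_bdd_continuous_conv[OF L L' w] by blast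
  qed
qed

end

theory Submission
  imports Defs
begin

text \<open>
  Weak convergence in \<open>\<H>\<^sup>\<star>\<close> is reduced to one-dimensional marginals. For the finite-rank truncations
  \<open>S\<^sub>n \<circ> P\<close>, with \<open>P\<close> the projection onto \<open>V\<^sub>u\<close>, convergence of all marginals gives convergence of
  the integrals of linear combinations of \<open>L \<mapsto> cos (L \<omega>)\<close> and \<open>L \<mapsto> sin (L \<omega>)\<close>; by
  Stone-Weierstrass these approximate any bounded continuous function on a compact box that carries
  almost all mass. Condition \<open>G\<^sub>2\<close> removes the
  truncation. The marginal of \<open>S\<close> at \<open>\<omega>\<close> is identified through its characteristic function:
  the reproducing property turns \<open>T\<^sub>\<sigma>\<close> into \<open>\<sigma>(\<omega>, \<eta>) = \<langle>T\<^sub>\<sigma> \<omega>, \<eta>\<rangle>\<close>, so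
  \<open>\<sigma>(\<omega>, \<omega>) = \<Sum> \<lambda>\<^sub>i \<langle>\<omega>, \<phi>\<^sub>i\<rangle>\<^sup>2\<close>, and \<open>G\<^sub>1\<close> gives \<open>\<Sum> \<lambda>\<^sub>i < \<infinity>\<close> in whichever basis it is stated.
\<close>

section \<open>Bases of a Hilbert space and of its dual\<close>

text \<open>
  Zero vectors are allowed, so that a finite basis can be padded to a sequence.
\<close>

locale hilbert_basis =
  fixes e :: "nat \<Rightarrow> 'h::{real_inner, complete_space}"
  assumes orth: "i \<noteq> j \<Longrightarrow> e i \<bullet> e j = 0"
    and unit: "e i = 0 \<or> norm (e i) = 1"
    and total: "closure (span (range e)) = UNIV"
begin

section \<open>Orthogonal series, Fourier expansion and Riesz representation\<close>

lemma norm_sum_sq: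
  assumes "finite A"
  shows "(norm (\<Sum>i\<in>A. c i *\<^sub>R e i))\<^sup>2 = (\<Sum>i\<in>A. (c i)\<^sup>2 * (norm (e i))\<^sup>2)"
proof -
  have "(norm (\<Sum>i\<in>A. c i *\<^sub>R e i))\<^sup>2 = (\<Sum>i\<in>A. (norm (c i *\<^sub>R e i))\<^sup>2)"
    by (rule norm_sum_Pythagorean[OF assms]) (auto simp: pairwise_def orthogonal_def orth)
  then show ?thesis by (simp add: power_mult_distrib)
qed

lemma norm_sum_sq_le:
  assumes "finite A"
  shows "(norm (\<Sum>i\<in>A. c i *\<^sub>R e i))\<^sup>2 \<le> (\<Sum>i\<in>A. (c i)\<^sup>2)"
  unfolding norm_sum_sq[OF assms]
proof (rule sum_mono)
  fix i show "(c i)\<^sup>2 * (norm (e i))\<^sup>2 \<le> (c i)\<^sup>2"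
    using unit[of i] by auto
qed

lemma eq_0_if_orth:
  assumes "\<And>i. x \<bullet> e i = 0"
  shows "x = 0"
proof -
  have "closed {y. x \<bullet> y = 0}"
    by (intro closed_Collect_eq continuous_intros)
  moreover have "span (range e) \<subseteq> {y. x \<bullet> y = 0}"
    by (rule span_minimal) (use assms in \<open>auto simp: subspace_def inner_add_right\<close>)
  ultimately have "closure (span (range e)) \<subseteq> {y. x \<bullet> y = 0}"
    by (rule closure_minimal[rotated])
  then have "x \<bullet> x = 0" unfolding total by blast
  then show ?thesis by simp
qed

text \<open>By Pythagoras the squared norm of a block of the series is at most the block of squared
  coefficients, so the partial sums are Cauchy and completeness applies.\<close>

lemma summable_scaleR:
  assumes "summable (\<lambda>i. (c i)\<^sup>2)"
  shows "summable (\<lambda>i. c i *\<^sub>R e i)"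
proof -
  have "Cauchy (\<lambda>n. \<Sum>i<n. c i *\<^sub>R e i)"
  proof (rule CauchyI')
    fix r :: real assume r: "0 < r"
    then have "0 < r\<^sup>2" by simp
    with assms obtain N where N: "\<And>m n. N \<le> m \<Longrightarrow> norm (\<Sum>i=m..<n. (c i)\<^sup>2) < r\<^sup>2"
      unfolding summable_Cauchy by blast
    show "\<exists>M. \<forall>m\<ge>M. \<forall>n>m. dist (\<Sum>i<m. c i *\<^sub>R e i) (\<Sum>i<n. c i *\<^sub>R e i) < r"
    proof (intro exI allI impI)
      fix m n assume mn: "N \<le> m" "m < n"
      have split: "(\<Sum>i<n. c i *\<^sub>R e i) - (\<Sum>i<m. c i *\<^sub>R e i) = (\<Sum>i=m..<n. c i *\<^sub>R e i)"
        using mn by (simp add: sum_diff_nat_ivl lessThan_atLeast0)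
      have "(norm (\<Sum>i=m..<n. c i *\<^sub>R e i))\<^sup>2 \<le> (\<Sum>i=m..<n. (c i)\<^sup>2)"
        by (rule norm_sum_sq_le) simp
      also have "\<dots> < r\<^sup>2" using N[OF mn(1), of n] by simp
      finally have "norm (\<Sum>i=m..<n. c i *\<^sub>R e i) < r"
        by (rule power2_less_imp_less) (use r in simp)
      then show "dist (\<Sum>i<m. c i *\<^sub>R e i) (\<Sum>i<n. c i *\<^sub>R e i) < r"
        by (subst dist_commute) (simp add: dist_norm split)
    qed
  qed
  then show ?thesis
    by (simp add: summable_iff_convergent Cauchy_convergent)
qed

text \<open>Bessel's inequality for functionals: testing \<open>L\<close> on \<open>?v\<close>, the
  vector with its own coefficients, gives \<open>?s = L ?v\<close>. Since the squared norm of
  \<open>?v\<close> is at most \<open>?s\<close>, this yields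
  \<open>?s\<^sup>2 \<le> (norm L)\<^sup>2 * ?s\<close>, and dividing by \<open>?s\<close> bounds
  all partial sums.\<close>

lemma summable_blinfun_sq: "summable (\<lambda>i. (blinfun_apply L (e i))\<^sup>2)"
  for L :: "'h \<Rightarrow>\<^sub>L real"
proof (rule bounded_imp_summable)
  fix n
  let ?s = "\<Sum>i\<le>n. (blinfun_apply L (e i))\<^sup>2"
  let ?v = "\<Sum>i\<le>n. blinfun_apply L (e i) *\<^sub>R e i"
  have nn: "0 \<le> ?s" by (simp add: sum_nonneg)
  have "?s = blinfun_apply L ?v"
    by (simp add: blinfun.sum_right blinfun.scaleR_right power2_eq_square)
  also have "\<dots> \<le> norm L * norm ?v"
    using norm_blinfun[of L ?v] by simp
  finally have "?s\<^sup>2 \<le> (norm L * norm ?v)\<^sup>2"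
    using nn by (rule power_mono)
  also have "\<dots> \<le> (norm L)\<^sup>2 * ?s"
    using norm_sum_sq_le[of "{..n}" "\<lambda>i. blinfun_apply L (e i)"]
    by (simp add: power_mult_distrib mult_left_mono)
  finally have "?s * ?s \<le> (norm L)\<^sup>2 * ?s" by (simp add: power2_eq_square)
  then show "?s \<le> (norm L)\<^sup>2"
    using nn by (cases "?s = 0") (auto simp: mult_le_cancel_right)
qed simp

text \<open>Bessel makes the series converge to some \<open>z\<close>; then \<open>x - z\<close> is
  orthogonal to every \<open>e j\<close>, hence zero by totality.\<close>

lemma expansion: "(\<lambda>i. (x \<bullet> e i) *\<^sub>R e i) sums x"
proof -
  have "summable (\<lambda>i. (x \<bullet> e i)\<^sup>2)"
    using summable_blinfun_sq[of "blinfun_inner_right x"] by simp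
  then have "summable (\<lambda>i. (x \<bullet> e i) *\<^sub>R e i)" by (rule summable_scaleR)
  then obtain z where z: "(\<lambda>i. (x \<bullet> e i) *\<^sub>R e i) sums z"
    by (auto simp: summable_def)
  have "(x - z) \<bullet> e j = 0" for j
  proof -
    have "(\<lambda>i. ((x \<bullet> e i) *\<^sub>R e i) \<bullet> e j) sums (z \<bullet> e j)"
      using bounded_linear.sums[OF bounded_linear_inner_left z] .
    moreover have "(\<lambda>i. ((x \<bullet> e i) *\<^sub>R e i) \<bullet> e j) = (\<lambda>i. if i = j then x \<bullet> e j else 0)"
    proof
      fix i show "((x \<bullet> e i) *\<^sub>R e i) \<bullet> e j = (if i = j then x \<bullet> e j else 0)"
        using unit[of j] by (auto simp: orth norm_eq_1)
    qed
    ultimately have "z \<bullet> e j = x \<bullet> e j"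
      using sums_single[of j "\<lambda>_. x \<bullet> e j"] sums_unique2 by fastforce
    then show ?thesis by (simp add: inner_diff_left)
  qed
  then have "x - z = 0" by (rule eq_0_if_orth)
  with z show ?thesis by simp
qed

lemma blinfun_sums:
  "(\<lambda>i. (x \<bullet> e i) * blinfun_apply L (e i)) sums blinfun_apply L x" for L :: "'h \<Rightarrow>\<^sub>L real"
  using bounded_linear.sums[OF blinfun.bounded_linear_right expansion, of L x]
  by (simp add: blinfun.scaleR_right)

lemma parseval: "(\<lambda>i. (x \<bullet> e i)\<^sup>2) sums (norm x)\<^sup>2"
  using blinfun_sums[of x "blinfun_inner_right x"]
  unfolding power2_norm_eq_inner by (simp add: power2_eq_square)

lemma riesz: "\<exists>r. L = blinfun_inner_right r" for L :: "'h \<Rightarrow>\<^sub>L real"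
proof -
  obtain r where r: "(\<lambda>i. blinfun_apply L (e i) *\<^sub>R e i) sums r"
    using summable_scaleR[OF summable_blinfun_sq[of L]] by (auto simp: summable_def)
  have "blinfun_apply L x = r \<bullet> x" for x
  proof -
    have "(\<lambda>i. (blinfun_apply L (e i) *\<^sub>R e i) \<bullet> x) sums (r \<bullet> x)"
      using bounded_linear.sums[OF bounded_linear_inner_left r] .
    with blinfun_sums[of x L] show ?thesis
      by (simp add: inner_commute mult.commute sums_unique2)
  qed
  then show ?thesis by (intro exI[of _ r] blinfun_eqI) simp
qed

section \<open>Norms and truncations of functionals\<close>

lemma norm_blinfun_inner_right: "norm (blinfun_inner_right (r :: 'h)) = norm r"
proof (rule antisym)
  show "norm (blinfun_inner_right r) \<le> norm r"
    by (rule norm_blinfun_bound) (auto simp: Cauchy_Schwarz_ineq2)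
  have "norm r * norm r \<le> norm (blinfun_inner_right r) * norm r"
    using norm_blinfun[of "blinfun_inner_right r" r]
    by (simp add: power2_norm_eq_inner[symmetric] power2_eq_square)
  then show "norm r \<le> norm (blinfun_inner_right r)"
    by (cases "r = 0") auto
qed

lemma parseval_dual: "(\<lambda>i. (blinfun_apply L (e i))\<^sup>2) sums (norm L)\<^sup>2" for L :: "'h \<Rightarrow>\<^sub>L real"
proof -
  obtain r where "L = blinfun_inner_right r" using riesz by blast
  with parseval[of r] show ?thesis by (simp add: norm_blinfun_inner_right)
qed

text \<open>This is \<open>L\<close> composed with the projection onto the span of the first
  \<open>u\<close> vectors (see \<open>trunc_apply\<close>). Written as a finite combination of
  coordinate functionals it is visibly continuous in \<open>L\<close> and has finite-dimensional
  range.\<close>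

definition trunc :: "nat \<Rightarrow> ('h \<Rightarrow>\<^sub>L real) \<Rightarrow> ('h \<Rightarrow>\<^sub>L real)" where
  "trunc u L = (\<Sum>i<u. blinfun_apply L (e i) *\<^sub>R blinfun_inner_right (e i))"

lemma trunc_apply: "blinfun_apply (trunc u L) x = blinfun_apply L (\<Sum>i<u. (x \<bullet> e i) *\<^sub>R e i)"
  by (simp add: trunc_def blinfun.sum_left blinfun.sum_right blinfun.scaleR_left
      blinfun.scaleR_right inner_commute mult.commute)

lemma continuous_on_trunc [continuous_intros]: "continuous_on UNIV (trunc u)"
  unfolding trunc_def by (intro continuous_intros)

text \<open>Under the Riesz representation, truncations of \<open>L\<close> are the partial sums of
  the Fourier expansion of the representing vector.\<close>

lemma trunc_tendsto: "(\<lambda>u. trunc u L) \<longlonglongrightarrow> L"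
proof -
  obtain r where r: "L = blinfun_inner_right r" using riesz by blast
  have "(\<lambda>i. blinfun_inner_right ((r \<bullet> e i) *\<^sub>R e i)) sums L"
    unfolding r by (rule bounded_linear.sums[OF bounded_linear_blinfun_inner_right expansion])
  then show ?thesis
    by (simp add: sums_def trunc_def r
        linear_cmul[OF bounded_linear.linear[OF bounded_linear_blinfun_inner_right]])
qed

lemma orthogonal_projection_comp:
  "orthogonal_projection ((span (e ` {..<u}))\<^sup>\<bottom>) x = x - (\<Sum>i<u. (x \<bullet> e i) *\<^sub>R e i)"
  unfolding orthogonal_projection_def
proof (rule the_equality)
  let ?W = "span (e ` {..<u})"
  let ?p = "\<Sum>i<u. (x \<bullet> e i) *\<^sub>R e i"
  have p: "?p \<in> ?W"
    by (intro span_sum span_scale span_base) auto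
  have "subspace {w. orthogonal (x - ?p) w}"
    by (rule subspace_orthogonal_to_vector)
  moreover have "e ` {..<u} \<subseteq> {w. orthogonal (x - ?p) w}"
  proof safe
    fix j assume j: "j < u"
    have "(\<Sum>i<u. (x \<bullet> e i) * (e j \<bullet> e i)) = (\<Sum>i<u. if i = j then x \<bullet> e j else 0)"
    proof (rule sum.cong)
      fix i show "(x \<bullet> e i) * (e j \<bullet> e i) = (if i = j then x \<bullet> e j else 0)"
        using unit[of j] by (auto simp: orth norm_eq_1)
    qed simp
    with j have "e j \<bullet> (x - ?p) = 0"
      by (simp add: inner_diff_right inner_sum_right inner_commute[of _ x])
    then show "orthogonal (x - ?p) (e j)"
      by (simp add: orthogonal_def inner_commute[of _ "e j"])
  qed
  ultimately have "?W \<subseteq> {w. orthogonal (x - ?p) w}"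
    by (rule span_minimal[rotated])
  then have q: "x - ?p \<in> ?W\<^sup>\<bottom>"
    by (auto simp: orthogonal_comp_def intro: orthogonal_commute[THEN iffD1])
  show "x - ?p \<in> ?W\<^sup>\<bottom> \<and> (\<forall>w\<in>?W\<^sup>\<bottom>. orthogonal (x - (x - ?p)) w)"
    using p q by (auto simp: orthogonal_comp_def)
  fix y assume y: "y \<in> ?W\<^sup>\<bottom> \<and> (\<forall>w\<in>?W\<^sup>\<bottom>. orthogonal (x - y) w)"
  \<comment> \<open>For uniqueness, this difference equals \<open>?p - (x - y)\<close>. It lies in
    the complement, so it is orthogonal to both \<open>?p\<close> and \<open>x - y\<close>, hence to
    itself.\<close>
  have d: "y - (x - ?p) \<in> ?W\<^sup>\<bottom>"
    using y q by (auto intro: subspace_diff subspace_orthogonal_comp)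
  have "orthogonal (x - y) (y - (x - ?p))" "orthogonal ?p (y - (x - ?p))"
    using y d p by (auto simp: orthogonal_comp_def)
  then have "(y - (x - ?p)) \<bullet> (y - (x - ?p)) = 0"
    by (simp add: orthogonal_def algebra_simps inner_commute)
  then show "y = x - ?p" by simp
qed

text \<open>This identifies the operator norm in \<open>G2\<close> with the distance from
  \<open>L\<close> to its truncation, the quantity that the approximation criterion below
  controls.\<close>

lemma onorm_comp_projection:
  "onorm (blinfun_apply L \<circ> orthogonal_projection ((span (e ` {..<u}))\<^sup>\<bottom>)) = norm (L - trunc u L)"
proof -
  have "blinfun_apply L \<circ> orthogonal_projection ((span (e ` {..<u}))\<^sup>\<bottom>) = blinfun_apply (L - trunc u L)"
    by (rule ext) (simp add: orthogonal_projection_comp blinfun.diff_right blinfun.diff_left trunc_apply)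
  then show ?thesis by (simp add: norm_blinfun.rep_eq)
qed

end

lemma hilbert_basis_padded:
  fixes \<psi> :: "nat \<Rightarrow> 'h::{real_inner, complete_space}"
  assumes "orthonormal_basis J \<psi>"
  shows "hilbert_basis (\<lambda>i. if i \<in> J then \<psi> i else 0)" (is "hilbert_basis ?e")
proof
  fix i j show "i \<noteq> j \<Longrightarrow> ?e i \<bullet> ?e j = 0"
    using assms by (auto simp: orthonormal_basis_def)
  show "?e i = 0 \<or> norm (?e i) = 1"
    using assms by (auto simp: orthonormal_basis_def norm_eq_1)
  have "span (\<psi> ` J) \<subseteq> span (range ?e)"
    by (rule span_mono) auto
  moreover have "closure (span (\<psi> ` J)) = UNIV"
    using assms by (simp add: orthonormal_basis_def)
  ultimately show "closure (span (range ?e)) = UNIV"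
    by (metis closure_mono top.extremum_uniqueI)
qed

lemma span_padded:
  "span ((\<lambda>i. if i \<in> J then \<psi> i else 0) ` A) = span (\<psi> ` (J \<inter> A))"
proof (rule span_eq[THEN iffD2], intro conjI)
  show "(\<lambda>i. if i \<in> J then \<psi> i else 0) ` A \<subseteq> span (\<psi> ` (J \<inter> A))"
    by (auto intro: span_base span_0)
  show "\<psi> ` (J \<inter> A) \<subseteq> span ((\<lambda>i. if i \<in> J then \<psi> i else 0) ` A)"
    by (force intro: span_base)
qed

section \<open>Criteria for weak convergence\<close>

lemma integrable_bounded_borel:
  fixes f :: "'e::topological_space \<Rightarrow> real"
  assumes "prob_space L" "sets L = sets borel" "f \<in> borel_measurable borel" "bounded (range f)"
  shows "integrable L f"
proof -
  interpret prob_space L by fact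
  obtain B where "\<And>x. norm (f x) \<le> B" using assms(4) by (auto simp: bounded_iff)
  moreover have "f \<in> borel_measurable L"
    using assms(3) by (simp add: measurable_cong_sets[OF assms(2) refl])
  ultimately show ?thesis by (intro integrable_const_bound[of _ B]) auto
qed

text \<open>The integrand \<open>\<bar>f x - g x\<bar>\<close> is dominated by
  \<open>c + D * indicator A x\<close>. Both approximation criteria below use this with an
  exceptional set \<open>A\<close> of small mass.\<close>

lemma integral_diff_le_split:
  fixes f g :: "'e::topological_space \<Rightarrow> real"
  assumes L: "prob_space L" "sets L = sets borel"
    and fg: "integrable L f" "integrable L g"
    and A: "A \<in> sets borel" "measure L A \<le> d"
    and c: "0 \<le> c" "\<And>x. x \<notin> A \<Longrightarrow> \<bar>f x - g x\<bar> \<le> c"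
    and D: "0 \<le> D" "\<And>x. \<bar>f x - g x\<bar> \<le> D"
  shows "\<bar>integral\<^sup>L L f - integral\<^sup>L L g\<bar> \<le> c + D * d"
proof -
  interpret prob_space L by fact
  have A': "A \<in> sets L" using A L by simp
  have "\<bar>integral\<^sup>L L f - integral\<^sup>L L g\<bar> = \<bar>\<integral>x. f x - g x \<partial>L\<bar>"
    using fg by simp
  also have "\<dots> \<le> (\<integral>x. \<bar>f x - g x\<bar> \<partial>L)" by (rule integral_abs_bound)
  also have "\<dots> \<le> (\<integral>x. c + D * indicator A x \<partial>L)"
  proof (rule integral_mono)
    show "\<bar>f x - g x\<bar> \<le> c + D * indicator A x" for x
      using c(1) c(2)[of x] D(2)[of x] by (auto split: split_indicator intro: add_increasing)
    show "integrable L (\<lambda>x. c + D * indicator A x)"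
      using A' by (intro Bochner_Integration.integrable_add integrable_mult_right integrable_const
          integrable_real_indicator) (auto simp: emeasure_eq_measure)
  qed (use fg in auto)
  also have "\<dots> = c + D * measure L A"
    using A' prob_space
    by (subst Bochner_Integration.integral_add) (auto simp: emeasure_eq_measure)
  also have "\<dots> \<le> c + D * d" using A D by (simp add: mult_left_mono)
  finally show ?thesis .
qed

text \<open>A bounded continuous \<open>f\<close> is a pointwise limit from below of bounded
  Lipschitz functions, which gives the lower bound for the limit inferior of the integrals. The same
  bound for \<open>- f\<close> is the upper one.\<close>

lemma weakly_converges_if_lipschitz:
  fixes L :: "nat \<Rightarrow> 'e::metric_space measure"
  assumes L: "\<And>n. prob_space (L n)" "\<And>n. sets (L n) = sets borel"
    and L': "prob_space L'" "sets L' = sets borel"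
    and lip: "\<And>(f :: 'e \<Rightarrow> real) C. bounded (range f) \<Longrightarrow> C-lipschitz_on UNIV f \<Longrightarrow>
        (\<lambda>n. integral\<^sup>L (L n) f) \<longlonglongrightarrow> integral\<^sup>L L' f"
  shows "weakly_converges L L'"
proof -
  interpret L': prob_space L' by fact
  have lower: "\<forall>\<^sub>F n in sequentially. integral\<^sup>L L' f - r < integral\<^sup>L (L n) f"
    if f: "continuous_on UNIV f" "bounded (range f)" and r: "0 < r"
    for f :: "'e \<Rightarrow> real" and r
  proof -
    obtain B where B: "\<And>x. \<bar>f x\<bar> \<le> B"
      using f(2) by (auto simp: bounded_iff)
    \<comment> \<open>The inf-convolutions \<open>g k\<close> are Lipschitz and increase to \<open>f\<close>.\<close>
    define g where "g k x = (INF y. f y + real k * dist x y)" for k x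
    have bdd: "bdd_below (range (\<lambda>y. f y + real k * dist x y))" for k x
    proof (rule bdd_belowI2)
      fix y show "- B \<le> f y + real k * dist x y"
        using B[of y] by (intro add_increasing2) (auto simp: abs_le_iff)
    qed
    have g_le: "g k x \<le> f x" for k x
      unfolding g_def using cINF_lower[OF bdd, of x k x] by simp
    have g_ge: "- B \<le> g k x" for k x
      unfolding g_def
    proof (rule cINF_greatest)
      fix y show "- B \<le> f y + real k * dist x y"
        using B[of y] by (intro add_increasing2) (auto simp: abs_le_iff)
    qed simp
    have g_bdd: "\<bar>g k x\<bar> \<le> B" for k x
      using g_le[of k x] g_ge[of k x] B[of x] by (auto simp: abs_le_iff)
    then have g_bounded: "bounded (range (g k))" for k
      by (auto simp: bounded_iff)
    have step: "g k x \<le> g k x' + real k * dist x x'" for k x x'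
    proof -
      have "g k x - real k * dist x x' \<le> (INF y. f y + real k * dist x' y)"
      proof (rule cINF_greatest)
        fix y
        have "g k x \<le> f y + real k * dist x y"
          unfolding g_def by (rule cINF_lower[OF bdd]) simp
        also have "\<dots> \<le> f y + real k * (dist x x' + dist x' y)"
          by (simp add: mult_left_mono dist_triangle)
        finally show "g k x - real k * dist x x' \<le> f y + real k * dist x' y"
          by (simp add: algebra_simps)
      qed simp
      then show ?thesis by (simp add: g_def[of k x'])
    qed
    have g_lip: "(real k)-lipschitz_on UNIV (g k)" for k
    proof (rule lipschitz_onI)
      fix x x' show "dist (g k x) (g k x') \<le> real k * dist x x'"
        using step[of k x x'] step[of k x' x] by (simp add: dist_real_def abs_le_iff dist_commute)
    qed simp
    have g_lim: "(\<lambda>k. g k x) \<longlonglongrightarrow> f x" for x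
    proof (rule LIMSEQ_I)
      fix s :: real assume s: "0 < s"
      then obtain d where d: "0 < d" "\<And>y. dist y x < d \<Longrightarrow> dist (f y) (f x) < s / 2"
        using f(1) unfolding continuous_on_iff by (metis UNIV_I half_gt_zero)
      \<comment> \<open>For \<open>y\<close> at distance at least \<open>d\<close> from
        \<open>x\<close> the penalty \<open>k * dist x y\<close> is then at least
        \<open>2 * B\<close>, which bounds the oscillation of \<open>f\<close>. Only points near
        \<open>x\<close>, where \<open>f\<close> is close to \<open>f x\<close>, can pull the
        infimum down.\<close>
      obtain k0 where k0: "2 * B / d < real k0" using reals_Archimedean2 by blast
      have "norm (g k x - f x) < s" if k: "k0 \<le> k" for k
      proof -
        have "f x - s / 2 \<le> g k x"
          unfolding g_def
        proof (rule cINF_greatest)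
          fix y
          show "f x - s / 2 \<le> f y + real k * dist x y"
          proof (cases "dist y x < d")
            case True
            with d(2)[OF True] have "f x - s / 2 \<le> f y"
              unfolding dist_real_def by linarith
            then show ?thesis by (intro add_increasing2) auto
          next
            case False
            have "2 * B / d \<le> real k" using k0 k by simp
            then have "2 * B \<le> real k * d" using d by (simp add: pos_divide_le_eq)
            also have "\<dots> \<le> real k * dist x y"
              using False by (intro mult_left_mono) (auto simp: dist_commute)
            finally show ?thesis using B[of x] B[of y] s by (auto simp: abs_le_iff)
          qed
        qed simp
        then show ?thesis using g_le[of k x] s by simp
      qed
      then show "\<exists>no. \<forall>n\<ge>no. norm (g n x - f x) < s" by blast
    qed
    have cont_g: "continuous_on UNIV (g k)" for k
      using g_lip lipschitz_on_continuous_on by blast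
    have meas: "g k \<in> borel_measurable borel" "f \<in> borel_measurable borel" for k
      using cont_g f(1) by (auto intro: borel_measurable_continuous_onI)
    have "(\<lambda>k. integral\<^sup>L L' (g k)) \<longlonglongrightarrow> integral\<^sup>L L' f"
    proof (rule integral_dominated_convergence[where w = "\<lambda>_. B"])
      show "AE x in L'. norm (g k x) \<le> B" for k using g_bdd by simp
    qed (use meas g_lim in \<open>auto simp: measurable_cong_sets[OF L'(2) refl]\<close>)
    then have "\<forall>\<^sub>F k in sequentially. integral\<^sup>L L' f - r / 2 < integral\<^sup>L L' (g k)"
      using r by (intro order_tendstoD(1)[of _ "integral\<^sup>L L' f"]) auto
    then obtain k where k: "integral\<^sup>L L' f - r / 2 < integral\<^sup>L L' (g k)"
      using eventually_sequentially by auto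
    have "\<forall>\<^sub>F n in sequentially. integral\<^sup>L L' (g k) - r / 2 < integral\<^sup>L (L n) (g k)"
      using lip[OF g_bounded g_lip] r by (intro order_tendstoD(1)[of _ "integral\<^sup>L L' (g k)"]) auto
    then show ?thesis
    proof (rule eventually_mono)
      fix n assume "integral\<^sup>L L' (g k) - r / 2 < integral\<^sup>L (L n) (g k)"
      moreover have "integral\<^sup>L (L n) (g k) \<le> integral\<^sup>L (L n) f"
        using g_le meas f(2) g_bounded
        by (intro integral_mono integrable_bounded_borel L) auto
      ultimately show "integral\<^sup>L L' f - r < integral\<^sup>L (L n) f" using k by simp
    qed
  qed
  show ?thesis
    unfolding weakly_converges_def
  proof (intro allI impI, elim conjE)
    fix f :: "'e \<Rightarrow> real"
    assume f: "continuous_on UNIV f" "bounded (range f)"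
    show "(\<lambda>n. integral\<^sup>L (L n) f) \<longlonglongrightarrow> integral\<^sup>L L' f"
    proof (rule tendstoI)
      fix r :: real assume r: "0 < r"
      have "continuous_on UNIV (\<lambda>x. - f x)" "bounded (range (\<lambda>x. - f x))"
        using f by (auto intro: continuous_on_minus simp: bounded_iff)
      from lower[OF f r] lower[OF this r]
      show "\<forall>\<^sub>F n in sequentially. dist (integral\<^sup>L (L n) f) (integral\<^sup>L L' f) < r"
        by eventually_elim (auto simp: dist_real_def abs_less_iff)
    qed
  qed
qed

text \<open>A three-term comparison. Replacing \<open>f\<close> by \<open>f \<circ> g u\<close>
  costs little under \<open>L n\<close> by \<open>tail\<close>, since \<open>f\<close> is Lipschitz,
  and little under \<open>L'\<close> by \<open>lim\<close> and dominated convergence; for fixed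
  \<open>u\<close> the integrals of \<open>f \<circ> g u\<close> converge by
  \<open>conv\<close>.\<close>

lemma weakly_converges_if_approximated:
  fixes L :: "nat \<Rightarrow> 'e::metric_space measure" and g :: "nat \<Rightarrow> 'e \<Rightarrow> 'e"
  assumes L: "\<And>n. prob_space (L n)" "\<And>n. sets (L n) = sets borel"
    and L': "prob_space L'" "sets L' = sets borel"
    and g: "\<And>u. continuous_on UNIV (g u)"
    and conv: "\<And>u. weakly_converges (\<lambda>n. distr (L n) borel (g u)) (distr L' borel (g u))"
    and lim: "\<And>x. (\<lambda>u. g u x) \<longlonglongrightarrow> x"
    and tail: "\<And>r. 0 < r \<Longrightarrow>
      (\<lambda>u. limsup (\<lambda>n. ereal (measure (L n) {x. r \<le> dist x (g u x)}))) \<longlonglongrightarrow> 0"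
  shows "weakly_converges L L'"
proof (rule weakly_converges_if_lipschitz[OF L L'])
  interpret L': prob_space L' by fact
  fix f :: "'e \<Rightarrow> real" and C :: real
  assume f: "bounded (range f)" "C-lipschitz_on UNIV f"
  obtain B where B: "\<And>x. \<bar>f x\<bar> \<le> B" using f(1) by (auto simp: bounded_iff)
  have B0: "0 \<le> B" using B[of undefined] by linarith
  have C0: "0 \<le> C" using f(2) by (rule lipschitz_on_nonneg)
  have cont: "continuous_on UNIV f" using f(2) by (rule lipschitz_on_continuous_on)
  have contg: "continuous_on UNIV (\<lambda>x. f (g u x))" for u
    using continuous_on_compose2[OF cont g] by auto
  have bg: "bounded (range (\<lambda>x. f (g u x)))" for u using B by (auto simp: bounded_iff)
  have g_meas: "g u \<in> borel_measurable borel" for u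
    using g by (rule borel_measurable_continuous_onI)
  have meas: "f \<in> borel_measurable borel" "(\<lambda>x. f (g u x)) \<in> borel_measurable borel" for u
    using cont contg by (auto intro: borel_measurable_continuous_onI)
  have conv': "(\<lambda>n. \<integral>x. f (g u x) \<partial>L n) \<longlonglongrightarrow> (\<integral>x. f (g u x) \<partial>L')" for u
  proof -
    have "g u \<in> measurable (L n) borel" "g u \<in> measurable L' borel" for n
      using g_meas by (auto simp: measurable_cong_sets[OF L(2) refl] measurable_cong_sets[OF L'(2) refl])
    moreover have "(\<lambda>n. integral\<^sup>L (distr (L n) borel (g u)) f) \<longlonglongrightarrow> integral\<^sup>L (distr L' borel (g u)) f"
      using conv[of u] cont f(1) unfolding weakly_converges_def by blast
    ultimately show ?thesis using meas by (simp add: integral_distr)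
  qed
  have lim': "(\<lambda>u. \<integral>x. f (g u x) \<partial>L') \<longlonglongrightarrow> integral\<^sup>L L' f"
  proof (rule integral_dominated_convergence[where w = "\<lambda>_. B"])
    show "AE x in L'. (\<lambda>u. f (g u x)) \<longlonglongrightarrow> f x"
    proof (rule AE_I2)
      fix x show "(\<lambda>u. f (g u x)) \<longlonglongrightarrow> f x"
        using cont lim continuous_on_tendsto_compose[OF cont lim] by simp
    qed
  qed (use meas B in \<open>auto simp: measurable_cong_sets[OF L'(2) refl]\<close>)
  show "(\<lambda>n. integral\<^sup>L (L n) f) \<longlonglongrightarrow> integral\<^sup>L L' f"
  proof (rule tendstoI)
    fix r :: real assume r: "0 < r"
    \<comment> \<open>The replacement under \<open>L n\<close> costs at most
      \<open>C * d + 2 * B * d\<close>, and the other two comparisons cost less than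
      \<open>d\<close> each, so the total stays below \<open>r\<close>.\<close>
    define d where "d = r / (C + 2 * B + 4)"
    have d: "0 < d" and dr: "C * d + 2 * B * d + 4 * d = r"
      using r B0 C0 by (auto simp: d_def field_simps add_nonneg_eq_0_iff)
    have "\<forall>\<^sub>F u in sequentially. limsup (\<lambda>n. ereal (measure (L n) {x. d \<le> dist x (g u x)})) < ereal d"
      using tail[OF d] d by (intro order_tendstoD(2)[of _ 0]) auto
    moreover have "\<forall>\<^sub>F u in sequentially. dist (\<integral>x. f (g u x) \<partial>L') (integral\<^sup>L L' f) < d"
      using lim' d by (rule tendstoD)
    ultimately have "\<forall>\<^sub>F u in sequentially. limsup (\<lambda>n. ereal (measure (L n) {x. d \<le> dist x (g u x)})) < ereal d
        \<and> dist (\<integral>x. f (g u x) \<partial>L') (integral\<^sup>L L' f) < d"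
      by (rule eventually_conj)
    then obtain u where u: "limsup (\<lambda>n. ereal (measure (L n) {x. d \<le> dist x (g u x)})) < ereal d"
        "dist (\<integral>x. f (g u x) \<partial>L') (integral\<^sup>L L' f) < d"
      using eventually_sequentially by auto
    let ?A = "{x. d \<le> dist x (g u x)}"
    have A: "?A \<in> sets borel"
      using g by (intro borel_closed closed_Collect_le continuous_intros)
    have "\<forall>\<^sub>F n in sequentially. ereal (measure (L n) ?A) < ereal d"
      using u(1) by (rule Limsup_lessD)
    moreover have "\<forall>\<^sub>F n in sequentially. dist (\<integral>x. f (g u x) \<partial>L n) (\<integral>x. f (g u x) \<partial>L') < d"
      using conv' d by (rule tendstoD)
    ultimately show "\<forall>\<^sub>F n in sequentially. dist (integral\<^sup>L (L n) f) (integral\<^sup>L L' f) < r"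
    proof eventually_elim
      case (elim n)
      have "\<bar>integral\<^sup>L (L n) f - (\<integral>x. f (g u x) \<partial>L n)\<bar> \<le> C * d + (2 * B) * d"
      proof (rule integral_diff_le_split[OF L _ _ A])
        show "integrable (L n) f" "integrable (L n) (\<lambda>x. f (g u x))"
          by (intro integrable_bounded_borel L meas f(1) bg)+
        show "measure (L n) ?A \<le> d" using elim by simp
        show "\<bar>f x - f (g u x)\<bar> \<le> 2 * B" for x
          using B[of x] B[of "g u x"] by linarith
        fix x assume "x \<notin> ?A"
        then have "C * dist x (g u x) \<le> C * d" using C0 by (intro mult_left_mono) auto
        then show "\<bar>f x - f (g u x)\<bar> \<le> C * d"
          using lipschitz_onD[OF f(2), of x "g u x"] by (simp add: dist_real_def)
      qed (use C0 B0 d in auto)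
      then show ?case using elim u(2) dr d by (simp add: dist_real_def abs_less_iff abs_le_iff)
    qed
  qed
qed

text \<open>Stone-Weierstrass approximates a test function by the algebra on a compact set carrying
  almost all mass. What remains is to keep the approximant bounded off that set by a constant
  depending only on the test function.\<close>

lemma weakly_converges_if_algebra:
  fixes L :: "nat \<Rightarrow> 'e::t2_space measure" and P :: "('e \<Rightarrow> real) \<Rightarrow> bool"
  assumes L: "\<And>n. prob_space (L n)" "\<And>n. sets (L n) = sets borel"
    and L': "prob_space L'" "sets L' = sets borel"
    and const: "\<And>c. P (\<lambda>_. c)"
    and add: "\<And>f g. P f \<Longrightarrow> P g \<Longrightarrow> P (\<lambda>x. f x + g x)"
    and mult: "\<And>f g. P f \<Longrightarrow> P g \<Longrightarrow> P (\<lambda>x. f x * g x)"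
    and cont: "\<And>f. P f \<Longrightarrow> continuous_on UNIV f"
    and bdd: "\<And>f. P f \<Longrightarrow> bounded (range f)"
    and sep: "\<And>x y. x \<noteq> y \<Longrightarrow> \<exists>f. P f \<and> f x \<noteq> f y"
    and conv: "\<And>f. P f \<Longrightarrow> (\<lambda>n. integral\<^sup>L (L n) f) \<longlonglongrightarrow> integral\<^sup>L L' f"
    and tight: "\<And>r. 0 < r \<Longrightarrow> \<exists>K. compact K \<and>
        (\<forall>\<^sub>F n in sequentially. measure (L n) (- K) \<le> r) \<and> measure L' (- K) \<le> r"
  shows "weakly_converges L L'"
  unfolding weakly_converges_def
proof (intro allI impI, elim conjE)
  fix f :: "'e \<Rightarrow> real"
  assume f: "continuous_on UNIV f" "bounded (range f)"
  obtain B where B: "\<And>x. \<bar>f x\<bar> \<le> B" using f(2) by (auto simp: bounded_iff)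
  have B0: "0 \<le> B" using B[of undefined] by linarith
  have poly: "P (\<lambda>x. p (t x))" if "real_polynomial_function p" "P t" for p :: "real \<Rightarrow> real" and t
    using that
  proof (induction p rule: real_polynomial_function.induct)
    case (linear h)
    then obtain c where "h = (\<lambda>x. x * c)" by (auto simp: real_bounded_linear)
    then show ?case using mult[OF \<open>P t\<close> const[of c]] by simp
  qed (auto intro: const add mult)
  show "(\<lambda>n. integral\<^sup>L (L n) f) \<longlonglongrightarrow> integral\<^sup>L L' f"
  proof (rule tendstoI)
    fix r :: real assume r: "0 < r"
    \<comment> \<open>Two replacements at \<open>2 * d + (2 * B + 1) * d\<close> each and one
      convergence error \<open>d\<close> add up to less than \<open>4 * (B * d) + 8 * d\<close>. The
      bound \<open>d \<le> 1\<close> gives the constant \<open>2 * B + 1\<close> in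
      \<open>far\<close>.\<close>
    define d where "d = min 1 (r / (4 * B + 8))"
    have d: "0 < d" "d \<le> 1" using r B0 by (auto simp: d_def)
    have "d * (4 * B + 8) \<le> r" using B0 by (simp add: d_def pos_le_divide_eq[symmetric])
    then have dr: "4 * (B * d) + 8 * d \<le> r" by (simp add: algebra_simps)
    obtain K where K: "compact K" "\<forall>\<^sub>F n in sequentially. measure (L n) (- K) \<le> d" "measure L' (- K) \<le> d"
      using tight[OF d(1)] by blast
    have KB: "- K \<in> sets borel" using K(1) by (intro borel_open open_Compl compact_imp_closed)
    have "\<exists>t. P t \<and> (\<forall>x\<in>K. \<bar>f x - t x\<bar> < d)"
    proof (rule Stone_Weierstrass_HOL[OF K(1)])
      show "continuous_on K f" using f(1) by (rule continuous_on_subset) simp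
      show "continuous_on K h" if "P h" for h using cont[OF that] by (rule continuous_on_subset) simp
    qed (use const add mult sep d in auto)
    then obtain t where t: "P t" "\<And>x. x \<in> K \<Longrightarrow> \<bar>f x - t x\<bar> < d" by blast
    obtain b where b: "\<And>x. \<bar>t x\<bar> \<le> b" using bdd[OF t(1)] by (auto simp: bounded_iff)
    \<comment> \<open>Outside \<open>K\<close> the approximant \<open>t\<close> may be much larger than \<open>f\<close>. Clamping it to \<open>[-B, B]\<close> leaves
      the algebra, so the clamp is replaced by a polynomial close to it on the range of \<open>t\<close>.\<close>
    define h where "h y = max (- B) (min B y)" for y :: real
    have "continuous_on {-b..b} h" unfolding h_def by (intro continuous_intros)
    then obtain p where p: "real_polynomial_function p" "\<And>y. y \<in> {-b..b} \<Longrightarrow> \<bar>h y - p y\<bar> < d"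
      using Stone_Weierstrass_real_polynomial_function[OF compact_Icc _ d(1)] by blast
    define q where "q x = p (t x)" for x
    have q: "P q" unfolding q_def using poly[OF p(1) t(1)] .
    have hq: "\<bar>h (t x) - q x\<bar> < d" for x
      unfolding q_def using p(2)[of "t x"] b[of x] by (auto simp: abs_le_iff)
    have hB: "\<bar>h y\<bar> \<le> B" for y using B0 by (auto simp: h_def)
    have close: "\<bar>f x - q x\<bar> \<le> 2 * d" if "x \<notin> - K" for x
    proof -
      \<comment> \<open>As \<open>f\<close> takes values in \<open>[-B, B]\<close>, clamping
        \<open>t\<close> can only bring it nearer to \<open>f\<close>.\<close>
      have "\<bar>f x - h (t x)\<bar> \<le> \<bar>f x - t x\<bar>"
        using B[of x] by (auto simp: h_def max_def min_def)
      with t(2)[of x] hq[of x] that show ?thesis by auto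
    qed
    have far: "\<bar>f x - q x\<bar> \<le> 2 * B + 1" for x
      using B[of x] hB[of "t x"] hq[of x] d by linarith
    have meas: "f \<in> borel_measurable borel" "q \<in> borel_measurable borel"
      using f(1) cont[OF q] by (auto intro: borel_measurable_continuous_onI)
    have bound: "\<bar>integral\<^sup>L Q f - integral\<^sup>L Q q\<bar> \<le> 2 * d + (2 * B + 1) * d"
      if "prob_space Q" "sets Q = sets borel" "measure Q (- K) \<le> d" for Q
      using that d B0 meas f(2) bdd[OF q]
      by (intro integral_diff_le_split[OF that(1,2) _ _ KB] integrable_bounded_borel close far) auto
    have "\<forall>\<^sub>F n in sequentially. dist (integral\<^sup>L (L n) q) (integral\<^sup>L L' q) < d"
      using conv[OF q] d(1) by (rule tendstoD)
    with K(2) show "\<forall>\<^sub>F n in sequentially. dist (integral\<^sup>L (L n) f) (integral\<^sup>L L' f) < r"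
    proof eventually_elim
      case (elim n)
      from bound[OF L elim(1)] bound[OF L' K(3)] elim(2) dr d(1)
      show ?case unfolding dist_real_def by (simp add: algebra_simps abs_less_iff abs_le_iff)
    qed
  qed
qed

section \<open>Weak convergence on the dual from one-dimensional marginals\<close>

text \<open>The generators depend on \<open>L\<close> through a single value \<open>L w\<close>, and
  only linear operations are constructors. Convergence of integrals therefore follows by induction
  from one-dimensional marginals; closure under products is proved separately.\<close>

inductive trig_poly :: "(('h::real_normed_vector \<Rightarrow>\<^sub>L real) \<Rightarrow> real) \<Rightarrow> bool" where
  cos: "trig_poly (\<lambda>L. cos (blinfun_apply L w))"
| sin: "trig_poly (\<lambda>L. sin (blinfun_apply L w))"
| add: "trig_poly f \<Longrightarrow> trig_poly g \<Longrightarrow> trig_poly (\<lambda>L. f L + g L)"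
| cmult: "trig_poly f \<Longrightarrow> trig_poly (\<lambda>L. c * f L)"

lemma trig_poly_const: "trig_poly (\<lambda>_. c)"
  using trig_poly.cmult[OF trig_poly.cos[of 0], of c] by simp

text \<open>Product-to-sum formulas, with \<open>L w + L v = L (w + v)\<close> and likewise for
  differences, turn a product of generators into a linear combination of generators.\<close>

lemma trig_poly_cos_mult: "trig_poly f \<Longrightarrow> trig_poly (\<lambda>L. cos (blinfun_apply L w) * f L)"
proof (induction rule: trig_poly.induct)
  case (cos v)
  have "trig_poly (\<lambda>L. (1/2) * (cos (blinfun_apply L (w - v)) + cos (blinfun_apply L (w + v))))"
    by (intro trig_poly.intros)
  then show ?case by (simp add: cos_times_cos blinfun.add_right blinfun.diff_right)
next
  case (sin v)
  have "trig_poly (\<lambda>L. (1/2) * (sin (blinfun_apply L (w + v)) + (- 1) * sin (blinfun_apply L (w - v))))"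
    by (intro trig_poly.intros)
  then show ?case by (simp add: cos_times_sin blinfun.add_right blinfun.diff_right)
next
  case (add f g)
  then show ?case using trig_poly.add by (simp add: distrib_left)
next
  case (cmult f c)
  then show ?case using trig_poly.cmult[of "\<lambda>L. cos (blinfun_apply L w) * f L" c]
    by (simp add: algebra_simps)
qed

lemma trig_poly_sin_mult: "trig_poly f \<Longrightarrow> trig_poly (\<lambda>L. sin (blinfun_apply L w) * f L)"
proof (induction rule: trig_poly.induct)
  case (cos v)
  have "trig_poly (\<lambda>L. (1/2) * (sin (blinfun_apply L (w + v)) + sin (blinfun_apply L (w - v))))"
    by (intro trig_poly.intros)
  then show ?case by (simp add: sin_times_cos blinfun.add_right blinfun.diff_right)
next
  case (sin v)
  have "trig_poly (\<lambda>L. (1/2) * (cos (blinfun_apply L (w - v)) + (- 1) * cos (blinfun_apply L (w + v))))"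
    by (intro trig_poly.intros)
  then show ?case by (simp add: sin_times_sin blinfun.add_right blinfun.diff_right)
next
  case (add f g)
  then show ?case using trig_poly.add by (simp add: distrib_left)
next
  case (cmult f c)
  then show ?case using trig_poly.cmult[of "\<lambda>L. sin (blinfun_apply L w) * f L" c]
    by (simp add: algebra_simps)
qed

lemma trig_poly_mult:
  assumes "trig_poly f" "trig_poly g"
  shows "trig_poly (\<lambda>L. f L * g L)"
  using assms
proof (induction f rule: trig_poly.induct)
  case (add f1 f2)
  then show ?case using trig_poly.add by (simp add: distrib_right)
next
  case (cmult f c)
  then show ?case using trig_poly.cmult[of "\<lambda>L. f L * g L" c] by (simp add: algebra_simps)
qed (auto intro: trig_poly_cos_mult trig_poly_sin_mult)

lemma trig_poly_continuous: "trig_poly f \<Longrightarrow> continuous_on UNIV f"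
  by (induction rule: trig_poly.induct) (auto intro!: continuous_intros)

lemma trig_poly_bounded: "trig_poly f \<Longrightarrow> bounded (range f)"
proof (induction rule: trig_poly.induct)
  case (add f g)
  then obtain a b where "\<And>x. \<bar>f x\<bar> \<le> a" "\<And>x. \<bar>g x\<bar> \<le> b"
    by (auto simp: bounded_iff)
  then have "\<bar>f x + g x\<bar> \<le> a + b" for x
    by (meson abs_triangle_ineq add_mono order_trans)
  then show ?case by (auto simp: bounded_iff)
next
  case (cmult f c)
  then obtain a where "\<And>x. \<bar>f x\<bar> \<le> a" by (auto simp: bounded_iff)
  then have "\<bar>c * f x\<bar> \<le> \<bar>c\<bar> * a" for x by (simp add: abs_mult mult_left_mono)
  then show ?case by (auto simp: bounded_iff)
qed (auto simp: bounded_iff intro: exI[of _ 1])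

text \<open>Some \<open>w\<close> distinguishes the functionals, but sine is not injective.
  Rescaling \<open>w\<close> by \<open>t\<close> moves both values into \<open>[-1, 1]\<close>,
  inside the interval from \<open>- pi / 2\<close> to \<open>pi / 2\<close> where it is.\<close>

lemma trig_poly_separates:
  assumes "x \<noteq> y"
  shows "\<exists>f. trig_poly f \<and> f x \<noteq> f y"
proof -
  obtain w where w: "blinfun_apply x w \<noteq> blinfun_apply y w"
    using assms blinfun_eqI by blast
  define a b where "a = blinfun_apply x w" and "b = blinfun_apply y w"
  define t where "t = 1 / (1 + \<bar>a\<bar> + \<bar>b\<bar>)"
  have t: "0 < t" by (simp add: t_def add_pos_nonneg)
  have "t * \<bar>a\<bar> \<le> 1" "t * \<bar>b\<bar> \<le> 1"
    unfolding t_def by simp_all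
  then have small: "\<bar>t * a\<bar> \<le> 1" "\<bar>t * b\<bar> \<le> 1"
    using t by (simp_all add: abs_mult)
  have "sin (t * blinfun_apply x w) \<noteq> sin (t * blinfun_apply y w)"
  proof
    assume "sin (t * blinfun_apply x w) = sin (t * blinfun_apply y w)"
    then have "sin (t * a) = sin (t * b)" by (simp add: a_def b_def)
    moreover have "- (pi / 2) \<le> t * a" "t * a \<le> pi / 2" "- (pi / 2) \<le> t * b" "t * b \<le> pi / 2"
      using small pi_gt3 by linarith+
    ultimately have "t * a = t * b" by (blast intro: sin_inj_pi)
    with t w show False by (simp add: a_def b_def)
  qed
  then show ?thesis
    using trig_poly.sin[of "t *\<^sub>R w"] by (auto simp: blinfun.scaleR_right)
qed

text \<open>The continuous ramp \<open>h k\<close> vanishes for \<open>\<bar>y\<bar> \<le> k\<close>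
  and dominates the indicator of \<open>\<bar>y\<bar> > k + 1\<close>. For large \<open>k\<close>
  its integral under \<open>L'\<close> is below \<open>r\<close>, and weak convergence carries this
  over to \<open>L n\<close> for all large \<open>n\<close>.\<close>

lemma weakly_converges_real_tight:
  fixes L :: "nat \<Rightarrow> real measure"
  assumes L: "\<And>n. prob_space (L n)" "\<And>n. sets (L n) = sets borel"
    and L': "prob_space L'" "sets L' = sets borel"
    and conv: "weakly_converges L L'" and r: "0 < r"
  shows "\<exists>R\<ge>0. (\<forall>\<^sub>F n in sequentially. measure (L n) {y. R < \<bar>y\<bar>} \<le> r) \<and> measure L' {y. R < \<bar>y\<bar>} \<le> r"
proof -
  interpret L': prob_space L' by fact
  define h where "h k y = min 1 (max 0 (\<bar>y\<bar> - real k))" for k :: nat and y :: real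
  have h: "continuous_on UNIV (h k)" "bounded (range (h k))" "0 \<le> h k y" "\<bar>h k y\<bar> \<le> 1" for k y
    unfolding h_def by (auto intro!: continuous_intros exI[of _ 1] simp: bounded_iff)
  have hm: "h k \<in> borel_measurable borel" for k
    using h(1) by (rule borel_measurable_continuous_onI)
  have "(\<lambda>k. integral\<^sup>L L' (h k)) \<longlonglongrightarrow> integral\<^sup>L L' (\<lambda>_. 0)"
  proof (rule integral_dominated_convergence[where w = "\<lambda>_. 1"])
    show "AE y in L'. (\<lambda>k. h k y) \<longlonglongrightarrow> 0"
    proof (rule AE_I2)
      fix y
      obtain k0 where k0: "\<bar>y\<bar> < real k0" using reals_Archimedean2 by blast
      have "\<forall>\<^sub>F k in sequentially. h k y = 0"
        using eventually_ge_at_top[of k0] by eventually_elim (use k0 in \<open>auto simp: h_def\<close>)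
      then show "(\<lambda>k. h k y) \<longlonglongrightarrow> 0" by (rule tendsto_eventually)
    qed
  qed (use h hm in \<open>auto simp: measurable_cong_sets[OF L'(2) refl]\<close>)
  then have "\<forall>\<^sub>F k in sequentially. integral\<^sup>L L' (h k) < r"
    using r by (intro order_tendstoD(2)) auto
  then obtain k where k: "integral\<^sup>L L' (h k) < r"
    using eventually_sequentially by auto
  have "(\<lambda>n. integral\<^sup>L (L n) (h k)) \<longlonglongrightarrow> integral\<^sup>L L' (h k)"
    using conv h unfolding weakly_converges_def by blast
  then have ev: "\<forall>\<^sub>F n in sequentially. integral\<^sup>L (L n) (h k) < r"
    using k by (rule order_tendstoD(2))
  let ?A = "{y. real k + 1 < \<bar>y\<bar>}"
  have A: "?A \<in> sets borel" by (intro borel_open open_Collect_less continuous_intros)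
  have le: "measure Q ?A \<le> integral\<^sup>L Q (h k)" if Q: "prob_space Q" "sets Q = sets borel" for Q
  proof -
    interpret Q: prob_space Q by fact
    have "measure Q ?A = integral\<^sup>L Q (indicator ?A)"
      using A Q by simp
    also have "\<dots> \<le> integral\<^sup>L Q (h k)"
    proof (rule integral_mono)
      show "integrable Q (indicat_real ?A)" using A Q by (simp add: Q.emeasure_eq_measure)
      show "integrable Q (h k)" using Q hm h by (intro integrable_bounded_borel)
      show "indicator ?A y \<le> h k y" for y
        using h(3)[of k y] by (auto simp: h_def split: split_indicator)
    qed
    finally show ?thesis .
  qed
  show ?thesis
  proof (intro exI[of _ "real k + 1"] conjI)
    show "\<forall>\<^sub>F n in sequentially. measure (L n) ?A \<le> r"
      using ev by eventually_elim (use le[OF L] in \<open>meson less_imp_le order_trans\<close>)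
    show "measure L' ?A \<le> r" using le[OF L'] k by simp
  qed simp
qed

context hilbert_basis
begin

lemma weakly_converges_dual:
  fixes L :: "nat \<Rightarrow> ('h \<Rightarrow>\<^sub>L real) measure"
  assumes L: "\<And>n. prob_space (L n)" "\<And>n. sets (L n) = sets borel"
    and L': "prob_space L'" "sets L' = sets borel"
    and marginal: "\<And>w. weakly_converges (\<lambda>n. distr (L n) borel (\<lambda>x. blinfun_apply x w))
        (distr L' borel (\<lambda>x. blinfun_apply x w))"
    and tail: "\<And>r. 0 < r \<Longrightarrow>
      (\<lambda>u. limsup (\<lambda>n. ereal (measure (L n) {x. r \<le> dist x (trunc u x)}))) \<longlonglongrightarrow> 0"
  shows "weakly_converges L L'"
proof (rule weakly_converges_if_approximated[OF L L', where g = trunc])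
  show "continuous_on UNIV (trunc u)" for u by (rule continuous_on_trunc)
  show "(\<lambda>u. trunc u x) \<longlonglongrightarrow> x" for x by (rule trunc_tendsto)
  show "(\<lambda>u. limsup (\<lambda>n. ereal (measure (L n) {x. r \<le> dist x (trunc u x)}))) \<longlonglongrightarrow> 0"
    if "0 < r" for r using that by (rule tail)
next
  fix u
  note mc = measurable_cong_sets[OF L(2) refl] measurable_cong_sets[OF L'(2) refl]
  have tm: "trunc u \<in> borel_measurable borel"
    by (intro borel_measurable_continuous_onI continuous_on_trunc)
  have tmL: "trunc u \<in> measurable (L n) borel" "trunc u \<in> measurable L' borel" for n
    using tm by (simp_all add: mc)
  have em: "(\<lambda>x. blinfun_apply x w) \<in> borel_measurable borel" for w :: 'h
    by (intro borel_measurable_continuous_onI continuous_intros)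
  have emL: "(\<lambda>x. blinfun_apply x w) \<in> measurable (L n) borel"
    "(\<lambda>x. blinfun_apply x w) \<in> measurable L' borel" for n and w :: 'h
    using em by (simp_all add: mc)
  have conv1: "(\<lambda>n. \<integral>x. h (blinfun_apply x w) \<partial>L n) \<longlonglongrightarrow> (\<integral>x. h (blinfun_apply x w) \<partial>L')"
    if h: "continuous_on UNIV h" "bounded (range h)" for h :: "real \<Rightarrow> real" and w
  proof -
    have hm: "h \<in> borel_measurable borel" using h(1) by (rule borel_measurable_continuous_onI)
    have "(\<lambda>n. integral\<^sup>L (distr (L n) borel (\<lambda>x. blinfun_apply x w)) h) \<longlonglongrightarrow>
        integral\<^sup>L (distr L' borel (\<lambda>x. blinfun_apply x w)) h"
      using marginal[of w] h unfolding weakly_converges_def by blast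
    then show ?thesis
      unfolding integral_distr[OF emL(1) hm] integral_distr[OF emL(2) hm] .
  qed
  have trunc_int: "integrable (L n) (\<lambda>x. f (trunc u x))" "integrable L' (\<lambda>x. f (trunc u x))"
    if "trig_poly f" for f :: "('h \<Rightarrow>\<^sub>L real) \<Rightarrow> real" and n
  proof -
    have "f \<in> borel_measurable borel"
      using trig_poly_continuous[OF that] by (rule borel_measurable_continuous_onI)
    then have m: "(\<lambda>x. f (trunc u x)) \<in> borel_measurable borel"
      using tm by (rule measurable_compose[rotated])
    have b: "bounded (range (\<lambda>x. f (trunc u x)))"
      using trig_poly_bounded[OF that] by (rule bounded_subset) auto
    show "integrable (L n) (\<lambda>x. f (trunc u x))" "integrable L' (\<lambda>x. f (trunc u x))"
      by (rule integrable_bounded_borel[OF L m b], rule integrable_bounded_borel[OF L' m b])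
  qed
  show "weakly_converges (\<lambda>n. distr (L n) borel (trunc u)) (distr L' borel (trunc u))"
  proof (rule weakly_converges_if_algebra[where P = trig_poly])
    show "prob_space (distr (L n) borel (trunc u))" for n
      using prob_space.prob_space_distr[OF L(1) tmL(1)] .
    show "prob_space (distr L' borel (trunc u))"
      using prob_space.prob_space_distr[OF L'(1) tmL(2)] .
  next
    fix f :: "('h \<Rightarrow>\<^sub>L real) \<Rightarrow> real" assume f: "trig_poly f"
    have "(\<lambda>n. \<integral>x. f (trunc u x) \<partial>L n) \<longlonglongrightarrow> (\<integral>x. f (trunc u x) \<partial>L')"
      using f
    proof (induction rule: trig_poly.induct)
      case (cos w)
      \<comment> \<open>The truncation of \<open>x\<close> at \<open>w\<close> is \<open>x\<close>
        at the projection of \<open>w\<close>, so the marginal at that projected vector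
        decides.\<close>
      show ?case unfolding trunc_apply
        by (rule conv1) (auto intro!: continuous_intros exI[of _ 1] simp: bounded_iff)
    next
      case (sin w)
      show ?case unfolding trunc_apply
        by (rule conv1) (auto intro!: continuous_intros exI[of _ 1] simp: bounded_iff)
    next
      case (add f g)
      then show ?case by (simp add: trunc_int tendsto_add)
    next
      case (cmult f c)
      then show ?case by (simp add: tendsto_mult)
    qed
    moreover have fm: "f \<in> borel_measurable borel"
      using trig_poly_continuous[OF f] by (rule borel_measurable_continuous_onI)
    ultimately show "(\<lambda>n. integral\<^sup>L (distr (L n) borel (trunc u)) f) \<longlonglongrightarrow>
        integral\<^sup>L (distr L' borel (trunc u)) f"
      unfolding integral_distr[OF tmL(1) fm] integral_distr[OF tmL(2) fm] by simp
  next
    fix r :: real assume r: "0 < r"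
    \<comment> \<open>The mass \<open>r\<close> is shared among the \<open>u\<close> coordinates;
      the \<open>1\<close> covers \<open>u = 0\<close>.\<close>
    define d where "d = r / (real u + 1)"
    have d: "0 < d" using r by (simp add: d_def)
    have ud: "real u * d \<le> r" using r by (simp add: d_def field_simps)
    have "\<exists>R\<ge>0. (\<forall>\<^sub>F n in sequentially. measure (L n) {x. R < \<bar>blinfun_apply x (e i)\<bar>} \<le> d) \<and>
        measure L' {x. R < \<bar>blinfun_apply x (e i)\<bar>} \<le> d" for i
    proof -
      have "measure (distr Q borel (\<lambda>x. blinfun_apply x (e i))) {y. R < \<bar>y\<bar>}
          = measure Q {x. R < \<bar>blinfun_apply x (e i)\<bar>}"
        if Q: "sets Q = sets (borel :: ('h \<Rightarrow>\<^sub>L real) measure)" for Q R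
      proof -
        have "(\<lambda>x. blinfun_apply x (e i)) \<in> measurable Q borel"
          using em by (simp add: measurable_cong_sets[OF Q refl])
        moreover have "space Q = UNIV" using sets_eq_imp_space_eq[OF Q] by simp
        ultimately show ?thesis by (subst measure_distr) (auto simp: vimage_def)
      qed
      moreover have "\<exists>R\<ge>0. (\<forall>\<^sub>F n in sequentially.
          measure (distr (L n) borel (\<lambda>x. blinfun_apply x (e i))) {y. R < \<bar>y\<bar>} \<le> d) \<and>
          measure (distr L' borel (\<lambda>x. blinfun_apply x (e i))) {y. R < \<bar>y\<bar>} \<le> d"
        by (intro weakly_converges_real_tight marginal d prob_space.prob_space_distr L L' emL) auto
      ultimately show ?thesis using L(2) L'(2) by simp
    qed
    then obtain R where R: "\<And>i. 0 \<le> R i"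
      "\<And>i. \<forall>\<^sub>F n in sequentially. measure (L n) {x. R i < \<bar>blinfun_apply x (e i)\<bar>} \<le> d"
      "\<And>i. measure L' {x. R i < \<bar>blinfun_apply x (e i)\<bar>} \<le> d"
      by metis
    define F where "F c = (\<Sum>i<u. c i *\<^sub>R blinfun_inner_right (e i))" for c :: "nat \<Rightarrow> real"
    \<comment> \<open>The box is taken in all of \<open>nat \<Rightarrow> real\<close>, where
      Tychonoff's theorem makes it compact. \<open>F\<close> reads only the first \<open>u\<close>
      coordinates; below, the others are filled with \<open>0\<close>, which the box allows because
      \<open>R i\<close> is nonnegative.\<close>
    define K where "K = F ` (PiE UNIV (\<lambda>i. {- R i..R i}))"
    have "compactin (product_topology (\<lambda>_. euclideanreal) UNIV) (PiE UNIV (\<lambda>i. {- R i..R i}))"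
      unfolding compactin_PiE by simp
    then have "compact (PiE UNIV (\<lambda>i::nat. {- R i..R i}))"
      by (simp add: euclidean_product_topology)
    then have K: "compact K"
      unfolding K_def F_def
      by (rule compact_continuous_image[rotated])
        (intro continuous_intros continuous_on_product_coordinates continuous_on_subset[OF continuous_on_product_coordinates subset_UNIV])
    have sub: "trunc u -` (- K) \<subseteq> (\<Union>i<u. {x. R i < \<bar>blinfun_apply x (e i)\<bar>})"
    proof
      fix x assume x: "x \<in> trunc u -` (- K)"
      show "x \<in> (\<Union>i<u. {x. R i < \<bar>blinfun_apply x (e i)\<bar>})"
      proof (rule ccontr)
        assume "x \<notin> (\<Union>i<u. {x. R i < \<bar>blinfun_apply x (e i)\<bar>})"
        then have "(\<lambda>i. if i < u then blinfun_apply x (e i) else 0) \<in> PiE UNIV (\<lambda>i. {- R i..R i})"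
          using R(1) by (force simp: abs_le_iff not_less)
        moreover have "trunc u x = F (\<lambda>i. if i < u then blinfun_apply x (e i) else 0)"
          unfolding trunc_def F_def by (rule sum.cong) auto
        ultimately have "trunc u x \<in> K" by (simp add: K_def)
        with x show False by simp
      qed
    qed
    have bound: "measure (distr Q borel (trunc u)) (- K) \<le> r"
      if Q: "prob_space Q" "sets Q = sets (borel :: ('h \<Rightarrow>\<^sub>L real) measure)"
        and le: "\<And>i. i < u \<Longrightarrow> measure Q {x. R i < \<bar>blinfun_apply x (e i)\<bar>} \<le> d" for Q
    proof -
      interpret Q: prob_space Q by fact
      have sp: "space Q = UNIV" using sets_eq_imp_space_eq[OF Q(2)] by simp
      have "{x. R i < \<bar>blinfun_apply x (e i)\<bar>} \<in> sets Q" for i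
        unfolding Q(2) by (intro borel_open open_Collect_less continuous_intros)
      then have s: "(\<lambda>i. {x. R i < \<bar>blinfun_apply x (e i)\<bar>}) ` {..<u} \<subseteq> sets Q" by auto
      have "measure (distr Q borel (trunc u)) (- K) = measure Q (trunc u -` (- K))"
        using tm K sp
        by (subst measure_distr) (auto simp: measurable_cong_sets[OF Q(2) refl]
            intro!: borel_open open_Compl compact_imp_closed)
      also have "\<dots> \<le> measure Q (\<Union>i<u. {x. R i < \<bar>blinfun_apply x (e i)\<bar>})"
        using sub s by (intro Q.finite_measure_mono sets.finite_UN) auto
      also have "\<dots> \<le> (\<Sum>i<u. measure Q {x. R i < \<bar>blinfun_apply x (e i)\<bar>})"
        using s by (intro Q.finite_measure_subadditive_finite) auto
      also have "\<dots> \<le> (\<Sum>i<u. d)" using le by (intro sum_mono) auto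
      also have "\<dots> \<le> r" using ud by simp
      finally show ?thesis .
    qed
    have "\<forall>\<^sub>F n in sequentially. \<forall>i\<in>{..<u}. measure (L n) {x. R i < \<bar>blinfun_apply x (e i)\<bar>} \<le> d"
      using R(2) by (intro eventually_ball_finite) auto
    then have "\<forall>\<^sub>F n in sequentially. measure (distr (L n) borel (trunc u)) (- K) \<le> r"
      by eventually_elim (intro bound L, auto)
    moreover have "measure (distr L' borel (trunc u)) (- K) \<le> r"
      by (intro bound L' R(3))
    ultimately show "\<exists>K. compact K \<and>
        (\<forall>\<^sub>F n in sequentially. measure (distr (L n) borel (trunc u)) (- K) \<le> r) \<and>
        measure (distr L' borel (trunc u)) (- K) \<le> r"
      using K by blast
  qed (simp | fact trig_poly_const trig_poly.add trig_poly_mult trig_poly_continuous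
      trig_poly_bounded trig_poly_separates)+
qed

end

section \<open>Gaussian series\<close>

lemma char_normal_law:
  assumes "0 \<le> v"
  shows "char (normal_law 0 v) t = complex_of_real (exp (- (t\<^sup>2 * v) / 2))"
proof -
  have "char (normal_law 0 v) t = char std_normal_distribution (t * sqrt v)"
    unfolding normal_law_def char_def by (subst integral_distr) (auto simp: mult_ac)
  then show ?thesis
    using assms by (simp add: char_std_normal_distribution power_mult_distrib)
qed

lemma prob_space_normal_law: "prob_space (normal_law \<mu> v)"
  unfolding normal_law_def
  by (intro prob_space.prob_space_distr real_distribution.axioms(1) real_dist_normal_dist) simp

lemma distr_std_normal:
  assumes "distributed N lborel X std_normal_density"
  shows "distr N borel X = std_normal_distribution"
proof -
  have "distr N borel X = distr N lborel X" by (rule distr_cong) auto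
  then show ?thesis using assms by (simp add: distributed_def)
qed

text \<open>By \<open>lam_eq_0\<close> the padding indices of a finite basis carry eigenvalue zero,
  so formulas summed over all of \<open>nat\<close> stay exact.\<close>

locale gaussian_series = hilbert_basis e + N: prob_space N
  for e :: "nat \<Rightarrow> 'h::{real_inner, complete_space}" and N :: "'b measure" +
  fixes Z :: "nat \<Rightarrow> 'b \<Rightarrow> real" and lam :: "nat \<Rightarrow> real"
  assumes indep: "N.indep_vars (\<lambda>_. borel) Z UNIV"
    and std_normal: "distributed N lborel (Z i) std_normal_density"
    and lam_nonneg: "0 \<le> lam i"
    and lam_eq_0: "e i = 0 \<Longrightarrow> lam i = 0"
    and lam_summable: "summable lam"
begin

definition gterm :: "'b \<Rightarrow> nat \<Rightarrow> ('h \<Rightarrow>\<^sub>L real)" where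
  "gterm s i = (sqrt (lam i) * Z i s) *\<^sub>R blinfun_inner_right (e i)"

lemma Z_measurable [measurable]: "Z i \<in> borel_measurable N"
  using indep by (auto simp: N.indep_vars_def)

lemma gterm_apply_basis: "blinfun_apply (gterm s i) (e j) = (if i = j then sqrt (lam j) * Z j s else 0)"
  using unit[of j] lam_eq_0[of j] by (auto simp: gterm_def blinfun.scaleR_left orth norm_eq_1)

text \<open>The sum takes the value \<open>sqrt (lam j) * Z j s\<close> at \<open>e j\<close>, and
  Parseval in the dual adds up the squares. This produces the weighted chi-square series of the
  limit of the squared norms.\<close>

lemma suminf_sq:
  assumes "summable (gterm s)"
  shows "(\<lambda>i. lam i * (Z i s)\<^sup>2) sums (norm (suminf (gterm s)))\<^sup>2"
proof -
  have "blinfun_apply (suminf (gterm s)) (e j) = sqrt (lam j) * Z j s" for j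
  proof -
    have "(\<lambda>i. blinfun_apply (gterm s i) (e j)) sums blinfun_apply (suminf (gterm s)) (e j)"
      by (intro bounded_linear.sums[OF blinfun.bounded_linear_left] summable_sums assms)
    then show ?thesis
      unfolding gterm_apply_basis
      using sums_single[of j "\<lambda>_. sqrt (lam j) * Z j s"] sums_unique2 by fastforce
  qed
  with parseval_dual[of "suminf (gterm s)"] show ?thesis
    by (simp add: power_mult_distrib lam_nonneg)
qed

lemma summable_gterm_iff: "summable (gterm s) \<longleftrightarrow> summable (\<lambda>i. lam i * (Z i s)\<^sup>2)"
proof
  assume "summable (gterm s)"
  then show "summable (\<lambda>i. lam i * (Z i s)\<^sup>2)" using suminf_sq by (blast intro: sums_summable)
next
  assume "summable (\<lambda>i. lam i * (Z i s)\<^sup>2)"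
  then have "summable (\<lambda>i. (sqrt (lam i) * Z i s)\<^sup>2)"
    by (simp add: power_mult_distrib lam_nonneg)
  then have "summable (\<lambda>i. (sqrt (lam i) * Z i s) *\<^sub>R e i)" by (rule summable_scaleR)
  then have "summable (\<lambda>i. blinfun_inner_right ((sqrt (lam i) * Z i s) *\<^sub>R e i))"
    by (rule bounded_linear.summable[OF bounded_linear_blinfun_inner_right])
  then show "summable (gterm s)"
    by (simp add: gterm_def[abs_def] linear_cmul[OF bounded_linear.linear[OF bounded_linear_blinfun_inner_right]])
qed

lemma nn_integral_Z_sq: "(\<integral>\<^sup>+s. ennreal ((Z i s)\<^sup>2) \<partial>N) = 1"
proof -
  have "(\<integral>\<^sup>+s. ennreal ((Z i s)\<^sup>2) \<partial>N) = (\<integral>\<^sup>+x. ennreal (std_normal_density x) * ennreal (x\<^sup>2) \<partial>lborel)"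
    using distributed_nn_integral[OF std_normal[of i], of "\<lambda>x. ennreal (x\<^sup>2)"] by simp
  also have "\<dots> = (\<integral>\<^sup>+x. ennreal (std_normal_density x * x\<^sup>2) \<partial>lborel)"
    by (simp add: ennreal_mult)
  also have "\<dots> = ennreal (\<integral>x. std_normal_density x * x\<^sup>2 \<partial>lborel)"
    using std_normal_moment_even[of 1]
    by (intro nn_integral_eq_integral) (auto simp: has_bochner_integral_iff)
  also have "\<dots> = 1"
    using integral_std_normal_moment_even[of 1] by (simp add: fact_numeral)
  finally show ?thesis .
qed

text \<open>Convergence in the dual amounts to convergence of a series of nonnegative reals, whose
  expectation is \<open>suminf lam\<close> because every \<open>Z i\<close> has second moment one. A
  finite expectation forces almost sure finiteness.\<close>

lemma AE_summable: "AE s in N. summable (gterm s)"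
proof -
  have "(\<integral>\<^sup>+s. (\<Sum>i. ennreal (lam i * (Z i s)\<^sup>2)) \<partial>N) = (\<Sum>i. \<integral>\<^sup>+s. ennreal (lam i * (Z i s)\<^sup>2) \<partial>N)"
    by (intro nn_integral_suminf) measurable
  also have "\<dots> = (\<Sum>i. ennreal (lam i))"
    by (simp add: ennreal_mult' lam_nonneg nn_integral_cmult nn_integral_Z_sq)
  also have "\<dots> = ennreal (suminf lam)"
    by (intro suminf_ennreal2 lam_nonneg lam_summable)
  finally have "AE s in N. (\<Sum>i. ennreal (lam i * (Z i s)\<^sup>2)) \<noteq> \<infinity>"
    by (intro nn_integral_PInf_AE) (auto simp: ennreal_neq_top)
  then show ?thesis
  proof eventually_elim
    case (elim s)
    then have "summable (\<lambda>i. lam i * (Z i s)\<^sup>2)"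
      by (intro summable_suminf_not_top) (auto simp: lam_nonneg)
    then show ?case by (simp add: summable_gterm_iff)
  qed
qed

text \<open>
  The type of the dual is not known to be second countable, so sums of measurable functions need not
  be measurable; hence the detour through a continuous function on \<open>nat \<Rightarrow> real\<close>.
\<close>

lemma partial_sum_measurable: "(\<lambda>s. \<Sum>i<n. gterm s i) \<in> borel_measurable N"
proof -
  have "(\<lambda>x. \<Sum>i<n. (sqrt (lam i) * x i) *\<^sub>R blinfun_inner_right (e i)) \<in>
      borel_measurable (borel :: (nat \<Rightarrow> real) measure)"
    by (intro borel_measurable_continuous_onI continuous_intros continuous_on_product_coordinates)
  moreover have "(\<lambda>s i. Z i s) \<in> borel_measurable N"
    by (rule measurable_coordinatewise_then_product) simp
  ultimately show ?thesis
    unfolding gterm_def by (rule measurable_compose[rotated])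
qed

text \<open>A limit of measurable maps into a metric space is measurable if it exists at every
  point. The partial sums are therefore replaced by a constant wherever the series diverges.\<close>

lemma suminf_measurable: "(\<lambda>s. suminf (gterm s)) \<in> borel_measurable N"
proof -
  \<comment> \<open>Describing the convergence set by finiteness of an \<open>ennreal\<close> sum
    makes its measurability immediate.\<close>
  define D where "D = {s. (\<Sum>i. ennreal (lam i * (Z i s)\<^sup>2)) \<noteq> \<infinity>}"
  have D: "s \<in> D \<longleftrightarrow> summable (gterm s)" for s
  proof
    assume "s \<in> D"
    then show "summable (gterm s)"
      unfolding D_def summable_gterm_iff
      by (intro summable_suminf_not_top) (simp_all add: lam_nonneg)
  next
    assume "summable (gterm s)"
    then have "(\<Sum>i. ennreal (lam i * (Z i s)\<^sup>2)) = ennreal (\<Sum>i. lam i * (Z i s)\<^sup>2)"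
      unfolding summable_gterm_iff by (intro suminf_ennreal2) (simp_all add: lam_nonneg)
    then show "s \<in> D" by (simp add: D_def)
  qed
  \<comment> \<open>the junk value of \<^const>\<open>suminf\<close> on divergent series\<close>
  define c :: "'h \<Rightarrow>\<^sub>L real" where "c = (THE x. False)"
  have c: "suminf (gterm s) = c" if "s \<notin> D" for s
  proof -
    have "\<not> gterm s sums x" for x using that unfolding D summable_def by blast
    then show ?thesis by (simp add: suminf_def c_def)
  qed
  define F where "F n s = (if s \<in> D then \<Sum>i<n. gterm s i else c)" for n s
  have "{s \<in> space N. s \<in> D} \<in> sets N"
    unfolding D_def mem_Collect_eq by measurable
  then have "F n \<in> borel_measurable N" for n
    unfolding F_def[abs_def] by (intro measurable_If partial_sum_measurable) auto
  moreover have "(\<lambda>n. F n s) \<longlonglongrightarrow> suminf (gterm s)" for s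
    by (cases "s \<in> D") (auto simp: F_def c D summable_LIMSEQ)
  ultimately show ?thesis
    by (rule borel_measurable_LIMSEQ_metric)
qed

text \<open>Independence factors the characteristic function of a partial sum into Gaussian ones,
  whose exponents add. Almost sure convergence and dominated convergence pass to the limit.\<close>

lemma char_apply:
  "char (distr N borel (\<lambda>s. blinfun_apply (suminf (gterm s)) w)) t
     = complex_of_real (exp (- (t\<^sup>2 * (\<Sum>i. lam i * (w \<bullet> e i)\<^sup>2)) / 2))"
  if summ: "summable (\<lambda>i. lam i * (w \<bullet> e i)\<^sup>2)"
proof -
  define a where "a i = sqrt (lam i) * (w \<bullet> e i)" for i
  have a2: "(a i)\<^sup>2 = lam i * (w \<bullet> e i)\<^sup>2" for i
    by (simp add: a_def power_mult_distrib lam_nonneg)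
  have X: "(\<Sum>i<n. a i * Z i s) = blinfun_apply (\<Sum>i<n. gterm s i) w" for n s
    by (simp add: a_def gterm_def blinfun.sum_left blinfun.scaleR_left inner_commute mult_ac)
  have one: "char (distr N borel (\<lambda>s. a i * Z i s)) t = complex_of_real (exp (- (t\<^sup>2 * (a i)\<^sup>2) / 2))" for i
  proof -
    have "char (distr N borel (\<lambda>s. a i * Z i s)) t = char (distr N borel (Z i)) (t * a i)"
      by (simp add: char_def integral_distr mult_ac)
    then show ?thesis
      by (simp add: distr_std_normal[OF std_normal] char_std_normal_distribution power_mult_distrib)
  qed
  have "N.indep_vars (\<lambda>_. borel) (\<lambda>i s. a i * Z i s) UNIV"
    by (rule N.indep_vars_compose2[OF indep]) simp
  then have "char (distr N borel (\<lambda>s. \<Sum>i<n. a i * Z i s)) t = (\<Prod>i<n. char (distr N borel (\<lambda>s. a i * Z i s)) t)" for n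
    by (intro N.char_distr_sum) (rule N.indep_vars_subset, auto)
  then have part: "char (distr N borel (\<lambda>s. \<Sum>i<n. a i * Z i s)) t
      = complex_of_real (exp (- (t\<^sup>2 * (\<Sum>i<n. (a i)\<^sup>2)) / 2))" for n
    by (simp add: one exp_sum[symmetric] sum_distrib_left sum_divide_distrib sum_negf
        flip: of_real_prod)
  have "(\<lambda>n. complex_of_real (exp (- (t\<^sup>2 * (\<Sum>i<n. (a i)\<^sup>2)) / 2))) \<longlonglongrightarrow>
      complex_of_real (exp (- (t\<^sup>2 * (\<Sum>i. lam i * (w \<bullet> e i)\<^sup>2)) / 2))"
    unfolding a2 by (intro tendsto_intros summable_LIMSEQ summ) simp
  moreover have "(\<lambda>n. char (distr N borel (\<lambda>s. \<Sum>i<n. a i * Z i s)) t) \<longlonglongrightarrow>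
      char (distr N borel (\<lambda>s. blinfun_apply (suminf (gterm s)) w)) t"
  proof -
    have m: "(\<lambda>s. blinfun_apply (suminf (gterm s)) w) \<in> borel_measurable N"
      by (rule measurable_compose[OF suminf_measurable])
        (intro borel_measurable_continuous_onI continuous_intros)
    have "(\<lambda>n. \<integral>s. iexp (t * (\<Sum>i<n. a i * Z i s)) \<partial>N) \<longlonglongrightarrow>
        (\<integral>s. iexp (t * blinfun_apply (suminf (gterm s)) w) \<partial>N)"
    proof (rule integral_dominated_convergence[where w = "\<lambda>_. 1"])
      show "AE s in N. (\<lambda>n. iexp (t * (\<Sum>i<n. a i * Z i s))) \<longlonglongrightarrow> iexp (t * blinfun_apply (suminf (gterm s)) w)"
        using AE_summable
      proof eventually_elim
        case (elim s)
        then show ?case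
          unfolding X by (intro tendsto_intros bounded_linear.tendsto[OF blinfun.bounded_linear_left] summable_LIMSEQ)
      qed
    qed (use m in \<open>auto\<close>)
    then show ?thesis using m by (simp add: char_def integral_distr)
  qed
  ultimately show ?thesis
    unfolding part using LIMSEQ_unique by blast
qed

end

section \<open>The limit theorem\<close>

lemma bounded_linear_if_continuous:
  fixes f :: "'a::real_normed_vector \<Rightarrow> 'b::real_normed_vector"
  assumes "linear f" and "isCont f 0"
  shows "bounded_linear f"
proof -
  interpret linear f by fact
  obtain d where d: "0 < d" "\<And>x. norm x < d \<Longrightarrow> norm (f x) < 1"
    using \<open>isCont f 0\<close> unfolding continuous_at_eps_delta
    by (metis dist_0_norm dist_commute zero zero_less_one)
  have "norm (f x) \<le> norm x * (2 / d)" for x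
  proof (cases "x = 0")
    case False
    \<comment> \<open>This gives \<open>c *\<^sub>R x\<close> norm \<open>d / 2\<close>, inside the
      ball where \<open>f\<close> is bounded by one.\<close>
    define c where "c = d / (2 * norm x)"
    have c: "0 < c" using d False by (simp add: c_def)
    have "norm (c *\<^sub>R x) < d" using d False by (simp add: c_def)
    then have "c * norm (f x) < 1" using d(2) c by (fastforce simp: scaleR)
    then have "norm (f x) \<le> 1 / c" using c by (simp add: pos_le_divide_eq mult.commute)
    then show ?thesis by (simp add: c_def mult.commute)
  qed (simp add: zero)
  then show ?thesis
    by (intro bounded_linear.intro \<open>linear f\<close> bounded_linear_axioms.intro) blast
qed

text \<open>If \<open>r\<close> is the Riesz vector of \<open>f\<close>, the reproducing property
  gives \<open>app r x = f (kernel_at app K x)\<close>, which is \<open>app v x\<close>; injectivity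
  of \<open>app\<close> yields \<open>v = r\<close>. It is applied with
  \<open>f = \<sigma> w\<close> and \<open>v = T w\<close>.\<close>

lemma (in hilbert_basis) rkhs_operator_inner:
  fixes app :: "'h \<Rightarrow> 'x \<Rightarrow> real"
  assumes rkhs: "rkhs app K"
    and f: "bounded_linear f"
    and v: "\<And>x. app v x = f (kernel_at app K x)"
  shows "f w = v \<bullet> w"
proof -
  obtain r where "Blinfun f = blinfun_inner_right r" using riesz by blast
  then have r: "f y = r \<bullet> y" for y
    using bounded_linear_Blinfun_apply[OF f] by (metis blinfun_inner_right.rep_eq)
  have "app v = app r"
    using rkhs v by (intro ext) (simp add: rkhs_def r)
  then have "v = r" using rkhs by (simp add: rkhs_def inj_eq)
  then show ?thesis by (simp add: r)
qed

text \<open>The continuous mapping theorem: composing a bounded continuous test function with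
  \<open>g\<close> gives another one.\<close>

lemma weakly_converges_distr:
  fixes g :: "'e::topological_space \<Rightarrow> 'f::topological_space"
  assumes meas: "\<And>n. X n \<in> borel_measurable (L n)" "X' \<in> borel_measurable L'"
    and g: "continuous_on UNIV g"
    and conv: "weakly_converges (\<lambda>n. distr (L n) borel (X n)) (distr L' borel X')"
  shows "weakly_converges (\<lambda>n. distr (L n) borel (\<lambda>s. g (X n s))) (distr L' borel (\<lambda>s. g (X' s)))"
  unfolding weakly_converges_def
proof (intro allI impI, elim conjE)
  fix f :: "'f \<Rightarrow> real" assume f: "continuous_on UNIV f" "bounded (range f)"
  have gm: "g \<in> borel_measurable borel" using g by (rule borel_measurable_continuous_onI)
  have fm: "f \<in> borel_measurable borel" using f(1) by (rule borel_measurable_continuous_onI)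
  have fgm: "(\<lambda>x. f (g x)) \<in> borel_measurable borel" using gm fm by (rule measurable_compose)
  have gX: "(\<lambda>s. g (X n s)) \<in> borel_measurable (L n)" "(\<lambda>s. g (X' s)) \<in> borel_measurable L'" for n
    using meas gm by (auto intro: measurable_compose)
  have "continuous_on UNIV (\<lambda>x. f (g x))"
    using continuous_on_compose2[OF f(1) g] by simp
  moreover have "bounded (range (\<lambda>x. f (g x)))"
    using f(2) by (rule bounded_subset) auto
  ultimately have "(\<lambda>n. integral\<^sup>L (distr (L n) borel (X n)) (\<lambda>x. f (g x))) \<longlonglongrightarrow>
      integral\<^sup>L (distr L' borel X') (\<lambda>x. f (g x))"
    using conv unfolding weakly_converges_def by blast
  then show "(\<lambda>n. integral\<^sup>L (distr (L n) borel (\<lambda>s. g (X n s))) f) \<longlonglongrightarrow>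
      integral\<^sup>L (distr L' borel (\<lambda>s. g (X' s))) f"
    unfolding integral_distr[OF meas(1) fgm] integral_distr[OF meas(2) fgm]
      integral_distr[OF gX(1) fm] integral_distr[OF gX(2) fm] .
qed

theorem theorem1:
  fixes app :: "'h::{real_inner, complete_space} \<Rightarrow> 'x \<Rightarrow> real"
    and K :: "'x \<Rightarrow> 'x \<Rightarrow> real"
    and M :: "'a measure"
    and S :: "nat \<Rightarrow> 'a \<Rightarrow> 'h \<Rightarrow>\<^sub>L real"
    and \<sigma> :: "'h \<Rightarrow> 'h \<Rightarrow> real"
    and T :: "'h \<Rightarrow> 'h"
    and I :: "nat set"
    and l :: "nat \<Rightarrow> real"
    and \<phi> :: "nat \<Rightarrow> 'h"
    and N :: "'b measure"
    and Z :: "nat \<Rightarrow> 'b \<Rightarrow> real"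
    and S_lim :: "'b \<Rightarrow> 'h \<Rightarrow>\<^sub>L real"
  assumes rkhs: "rkhs app K"
    and separable: "separable_space (euclidean :: 'h topology)"
    and prob_space_M: "prob_space M"
    and random_S: "\<And>n. S n \<in> borel_measurable M"
    and bilinear: "bilinear \<sigma>"
    and symmetric: "\<And>\<omega> \<eta>. \<sigma> \<omega> \<eta> = \<sigma> \<eta> \<omega>"
    and continuous: "continuous_on UNIV (\<lambda>(\<omega>, \<eta>). \<sigma> \<omega> \<eta>)"
    and G0: "\<And>(m::nat) (\<omega> :: nat \<Rightarrow> 'h). 1 \<le> m \<Longrightarrow>
        0 \<le> (\<Sum>i=1..m. \<Sum>j=1..m. \<sigma> (\<omega> i) (\<omega> j)) \<and>
        weak_conv_m (\<lambda>n. distr M borel (\<lambda>s. blinfun_apply (S n s) (\<Sum>i=1..m. \<omega> i)))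
          (normal_law 0 (\<Sum>i=1..m. \<Sum>j=1..m. \<sigma> (\<omega> i) (\<omega> j)))"
    and G1: "\<exists>J \<psi>. orthonormal_basis J \<psi> \<and>
        summable (\<lambda>i. if i \<in> J then \<sigma> (\<psi> i) (\<psi> i) else 0)"
    and G2: "\<exists>J \<psi>. orthonormal_basis J \<psi> \<and>
        (\<forall>\<epsilon>>0. (\<lambda>i. limsup (\<lambda>n. ereal (measure M {s \<in> space M.
            (onorm (blinfun_apply (S n s) \<circ>
               orthogonal_projection ((span (\<psi> ` (J \<inter> {..<i})))\<^sup>\<bottom>)))\<^sup>2 \<ge> \<epsilon>})))
          \<longlonglongrightarrow> 0)"
    and T: "\<And>\<omega> x. app (T \<omega>) x = \<sigma> \<omega> (kernel_at app K x)"
    and basis: "orthonormal_basis I \<phi>"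
    and eigen: "\<And>i. i \<in> I \<Longrightarrow> T (\<phi> i) = l i *\<^sub>R \<phi> i"
    and prob_space_N: "prob_space N"
    and indep_Z: "prob_space.indep_vars N (\<lambda>_. borel) Z UNIV"
    and normal_Z: "\<And>i. distributed N lborel (Z i) std_normal_density"
    and S_lim: "\<And>s. S_lim s = (\<Sum>i. limit_term I l \<phi> (\<lambda>i. Z i s) i)"
  shows "(AE s in N. summable (limit_term I l \<phi> (\<lambda>i. Z i s))) \<and>
    S_lim \<in> borel_measurable N \<and>
    weakly_converges (\<lambda>n. distr M borel (S n)) (distr N borel S_lim) \<and>
    weak_conv_m (\<lambda>n. distr M borel (\<lambda>s. (norm (S n s))\<^sup>2))
      (distr N borel (\<lambda>s. \<Sum>i. if i \<in> I then l i * (Z i s)\<^sup>2 else 0))"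
proof -
  interpret M: prob_space M by fact
  interpret N: prob_space N by fact
  define e where "e i = (if i \<in> I then \<phi> i else 0)" for i
  define lam where "lam i = (if i \<in> I then l i else 0)" for i
  interpret e: hilbert_basis e
    unfolding e_def by (rule hilbert_basis_padded[OF basis])

  \<comment> \<open>The form \<sigma> in the eigenbasis\<close>
  have \<sigma>_linear: "linear (\<sigma> w)" "linear (\<lambda>v. \<sigma> v w)" for w
    using bilinear by (auto simp: bilinear_def)
  have \<sigma>_bl: "bounded_linear (\<sigma> w)" for w
  proof (rule bounded_linear_if_continuous[OF \<sigma>_linear(1)])
    have "continuous_on UNIV (\<lambda>v. case (w, v) of (a, b) \<Rightarrow> \<sigma> a b)"
      by (rule continuous_on_compose2[OF continuous]) (auto intro!: continuous_intros)
    then show "isCont (\<sigma> w) 0" by (simp add: continuous_on_eq_continuous_at)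
  qed
  have \<sigma>_T: "\<sigma> w v = T w \<bullet> v" for w v
    by (rule e.rkhs_operator_inner[OF rkhs \<sigma>_bl T])
  have \<sigma>_0: "\<sigma> 0 w = 0" for w
    using linear_0[OF \<sigma>_linear(2)] .
  have \<sigma>_e: "\<sigma> (e i) w = lam i * (w \<bullet> e i)" for i w
    by (simp add: e_def lam_def \<sigma>_0) (simp add: \<sigma>_T eigen inner_commute)
  have \<sigma>_e': "\<sigma> w (e i) = lam i * (w \<bullet> e i)" for i w
    using symmetric[of w "e i"] \<sigma>_e by simp
  have \<sigma>_sums: "(\<lambda>i. lam i * (w \<bullet> e i)\<^sup>2) sums \<sigma> w w" for w
    using e.blinfun_sums[of w "Blinfun (\<sigma> w)"]
    by (simp add: bounded_linear_Blinfun_apply[OF \<sigma>_bl] \<sigma>_e' power2_eq_square mult_ac)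
  have G0': "0 \<le> \<sigma> w w \<and> weak_conv_m (\<lambda>n. distr M borel (\<lambda>s. blinfun_apply (S n s) w)) (normal_law 0 (\<sigma> w w))" for w
    using G0[of 1 "\<lambda>_. w"] by simp
  have lam_eq_0: "lam i = 0" if "e i = 0" for i
  proof (cases "i \<in> I")
    case True
    then have "e i \<bullet> e i = 1" using basis by (simp add: e_def orthonormal_basis_def)
    with that show ?thesis by simp
  qed (simp add: lam_def)
  have lam_norm: "lam i * (norm (e i))\<^sup>2 = lam i" for i
    using e.unit[of i] lam_eq_0[of i] by auto
  \<comment> \<open>The eigenvalue is \<open>\<sigma> (e i) (e i)\<close>, the limiting variance of
    the statistic at \<open>e i\<close>, when \<open>e i\<close> is a unit vector, and zero
    otherwise.\<close>
  have lam_nonneg: "0 \<le> lam i" for i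
    using G0'[of "e i"] lam_norm[of i] by (auto simp: \<sigma>_e power2_norm_eq_inner)

  \<comment> \<open>Finiteness of the trace\<close>
  have lam_summable: "summable lam"
  proof -
    obtain J \<psi> where \<psi>: "orthonormal_basis J \<psi>" "summable (\<lambda>i. if i \<in> J then \<sigma> (\<psi> i) (\<psi> i) else 0)"
      using G1 by blast
    define p where "p i = (if i \<in> J then \<psi> i else 0)" for i
    interpret p: hilbert_basis p
      unfolding p_def by (rule hilbert_basis_padded[OF \<psi>(1)])
    have "(\<lambda>i. if i \<in> J then \<sigma> (\<psi> i) (\<psi> i) else 0) = (\<lambda>i. \<sigma> (p i) (p i))"
      by (auto simp: p_def \<sigma>_0)
    with \<psi>(2) have summ: "summable (\<lambda>i. \<sigma> (p i) (p i))" by simp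
    show ?thesis
    proof (rule bounded_imp_summable)
      fix n
      \<comment> \<open>Comparing traces in two bases: Parseval in \<open>p\<close> expands each of
        finitely many eigenvalues, and exchanging with the finite sum leaves, for each
        \<open>k\<close>, a partial sum of the nonnegative series for
        \<open>\<sigma> (p k) (p k)\<close>.\<close>
      have "(\<lambda>k. lam i * (e i \<bullet> p k)\<^sup>2) sums lam i" for i
        using sums_mult[OF p.parseval[of "e i"], of "lam i"] by (simp add: lam_norm)
      then have "(\<lambda>k. \<Sum>i\<le>n. lam i * (e i \<bullet> p k)\<^sup>2) sums (\<Sum>i\<le>n. lam i)"
        by (rule sums_sum)
      moreover have "(\<Sum>i\<le>n. lam i * (e i \<bullet> p k)\<^sup>2) \<le> \<sigma> (p k) (p k)" for k
      proof -
        have "(\<Sum>i\<le>n. lam i * (p k \<bullet> e i)\<^sup>2) \<le> (\<Sum>i. lam i * (p k \<bullet> e i)\<^sup>2)"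
          by (rule sum_le_suminf) (use \<sigma>_sums[of "p k"] in \<open>auto simp: sums_iff lam_nonneg\<close>)
        with \<sigma>_sums[of "p k"] show ?thesis by (simp add: sums_iff inner_commute)
      qed
      ultimately show "(\<Sum>i\<le>n. lam i) \<le> (\<Sum>k. \<sigma> (p k) (p k))"
        by (intro sums_le[OF _ _ summable_sums[OF summ]])
    qed (rule lam_nonneg)
  qed

  \<comment> \<open>The limit and its marginals\<close>
  interpret G: gaussian_series e N Z lam
    by unfold_locales (use indep_Z normal_Z lam_nonneg lam_eq_0 lam_summable in auto)
  have term_eq: "limit_term I l \<phi> (\<lambda>i. Z i s) = G.gterm s" for s
    by (rule ext) (auto simp: limit_term_def G.gterm_def e_def lam_def)
  have S_lim_eq: "S_lim = (\<lambda>s. suminf (G.gterm s))"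
    by (rule ext) (simp add: S_lim term_eq)
  have S_lim_meas: "S_lim \<in> borel_measurable N"
    unfolding S_lim_eq by (rule G.suminf_measurable)
  have eval_meas: "(\<lambda>x. blinfun_apply x w) \<in> borel_measurable borel" for w :: 'h
    by (intro borel_measurable_continuous_onI continuous_intros)
  have Sw_meas: "(\<lambda>s. blinfun_apply (S n s) w) \<in> borel_measurable M"
    "(\<lambda>s. blinfun_apply (S_lim s) w) \<in> borel_measurable N" for n w
    by (rule measurable_compose[OF _ eval_meas], fact random_S S_lim_meas)+

  have law_S_lim: "distr N borel (\<lambda>s. blinfun_apply (S_lim s) w) = normal_law 0 (\<sigma> w w)" for w
  proof (rule Levy_uniqueness)
    show "real_distribution (distr N borel (\<lambda>s. blinfun_apply (S_lim s) w))"
      by (rule N.real_distribution_distr[OF Sw_meas(2)])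
    show "real_distribution (normal_law 0 (\<sigma> w w))"
      by (intro real_distribution.intro real_distribution_axioms.intro prob_space_normal_law)
        (auto simp: normal_law_def)
    show "char (distr N borel (\<lambda>s. blinfun_apply (S_lim s) w)) = char (normal_law 0 (\<sigma> w w))"
      using \<sigma>_sums[of w] G0'[of w]
      by (intro ext) (simp add: S_lim_eq G.char_apply char_normal_law sums_iff)
  qed

  \<comment> \<open>Convergence in the dual\<close>
  have main: "weakly_converges (\<lambda>n. distr M borel (S n)) (distr N borel S_lim)"
  proof -
    obtain J \<xi> where \<xi>: "orthonormal_basis J \<xi>"
      and tail: "\<And>r. 0 < r \<Longrightarrow> (\<lambda>i. limsup (\<lambda>n. ereal (measure M {s \<in> space M.
            (onorm (blinfun_apply (S n s) \<circ>
               orthogonal_projection ((span (\<xi> ` (J \<inter> {..<i})))\<^sup>\<bottom>)))\<^sup>2 \<ge> r}))) \<longlonglongrightarrow> 0"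
      using G2 by blast
    \<comment> \<open>Truncation uses the basis from \<open>G2\<close>, which may differ from the
      eigenbasis. This is harmless, as the marginals are known at every vector.\<close>
    define p where "p i = (if i \<in> J then \<xi> i else 0)" for i
    interpret p: hilbert_basis p
      unfolding p_def by (rule hilbert_basis_padded[OF \<xi>])
    have span_p: "span (\<xi> ` (J \<inter> {..<i})) = span (p ` {..<i})" for i
      unfolding p_def span_padded ..
    show ?thesis
    proof (rule p.weakly_converges_dual)
      show "prob_space (distr M borel (S n))" for n by (rule M.prob_space_distr[OF random_S])
      show "prob_space (distr N borel S_lim)" by (rule N.prob_space_distr[OF S_lim_meas])
    next
      fix w
      have 1: "distr (distr M borel (S n)) borel (\<lambda>x. blinfun_apply x w)
          = distr M borel (\<lambda>s. blinfun_apply (S n s) w)" for n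
        using distr_distr[OF eval_meas random_S] by (simp add: comp_def)
      have 2: "distr (distr N borel S_lim) borel (\<lambda>x. blinfun_apply x w)
          = distr N borel (\<lambda>s. blinfun_apply (S_lim s) w)"
        using distr_distr[OF eval_meas S_lim_meas] by (simp add: comp_def)
      show "weakly_converges (\<lambda>n. distr (distr M borel (S n)) borel (\<lambda>x. blinfun_apply x w))
          (distr (distr N borel S_lim) borel (\<lambda>x. blinfun_apply x w))"
        unfolding 1 2
        by (subst weakly_converges_iff_weak_conv_m)
          (use G0'[of w] in \<open>auto simp: law_S_lim intro!: M.real_distribution_distr Sw_meas
            simp flip: law_S_lim intro: N.real_distribution_distr\<close>)
    next
      fix r :: real assume r: "0 < r"
      \<comment> \<open>\<open>G2\<close> bounds the squared norm, so the threshold \<open>r\<close>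
        for the distance becomes \<open>r\<^sup>2\<close>.\<close>
      have "measure (distr M borel (S n)) {x. r \<le> dist x (p.trunc u x)} =
          measure M {s \<in> space M. (onorm (blinfun_apply (S n s) \<circ>
               orthogonal_projection ((span (\<xi> ` (J \<inter> {..<u})))\<^sup>\<bottom>)))\<^sup>2 \<ge> r\<^sup>2}" for n u
      proof -
        have "{x. r \<le> dist x (p.trunc u x)} \<in> sets borel"
          by (intro borel_closed closed_Collect_le continuous_intros)
        then have "measure (distr M borel (S n)) {x. r \<le> dist x (p.trunc u x)}
            = measure M {s \<in> space M. r \<le> dist (S n s) (p.trunc u (S n s))}"
          by (subst measure_distr[OF random_S]) (auto intro!: arg_cong[where f = "measure M"])
        then show ?thesis
          using r unfolding span_p p.onorm_comp_projection
          by (simp add: dist_norm abs_le_square_iff[symmetric])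
      qed
      with tail[of "r\<^sup>2"] r
      show "(\<lambda>u. limsup (\<lambda>n. ereal (measure (distr M borel (S n)) {x. r \<le> dist x (p.trunc u x)}))) \<longlonglongrightarrow> 0"
        by simp
    qed simp_all
  qed

  \<comment> \<open>The squared norm\<close>
  have psi: "weak_conv_m (\<lambda>n. distr M borel (\<lambda>s. (norm (S n s))\<^sup>2))
      (distr N borel (\<lambda>s. \<Sum>i. if i \<in> I then l i * (Z i s)\<^sup>2 else 0))"
  proof -
    have nm: "(\<lambda>x :: 'h \<Rightarrow>\<^sub>L real. (norm x)\<^sup>2) \<in> borel_measurable borel"
      by (intro borel_measurable_continuous_onI continuous_intros)
    have m1: "(\<lambda>s. (norm (S n s))\<^sup>2) \<in> borel_measurable M" for n
      by (rule measurable_compose[OF random_S nm])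
    have m2: "(\<lambda>s. (norm (S_lim s))\<^sup>2) \<in> borel_measurable N"
      by (rule measurable_compose[OF S_lim_meas nm])
    have eq: "(\<Sum>i. if i \<in> I then l i * (Z i s)\<^sup>2 else 0) = (\<Sum>i. lam i * (Z i s)\<^sup>2)" for s
      by (rule suminf_cong) (simp add: lam_def)
    \<comment> \<open>Where the series diverges both sides are built from default values of
      \<open>suminf\<close> and need not agree; almost sure equality suffices for equal
      laws.\<close>
    have "AE s in N. (norm (S_lim s))\<^sup>2 = (\<Sum>i. if i \<in> I then l i * (Z i s)\<^sup>2 else 0)"
      using G.AE_summable
    proof eventually_elim
      case (elim s)
      then show ?case using G.suminf_sq[OF elim] by (simp add: eq S_lim_eq sums_iff)
    qed
    then have "distr N borel (\<lambda>s. (norm (S_lim s))\<^sup>2)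
        = distr N borel (\<lambda>s. \<Sum>i. if i \<in> I then l i * (Z i s)\<^sup>2 else 0)"
      by (intro distr_cong_AE m2) (auto simp: eq)
    moreover have "weakly_converges (\<lambda>n. distr M borel (\<lambda>s. (norm (S n s))\<^sup>2))
        (distr N borel (\<lambda>s. (norm (S_lim s))\<^sup>2))"
      by (rule weakly_converges_distr[OF random_S S_lim_meas _ main]) (intro continuous_intros)
    ultimately show ?thesis
      using weakly_converges_iff_weak_conv_m[OF M.real_distribution_distr[OF m1] N.real_distribution_distr[OF m2]]
      by simp
  qed
  show ?thesis
    using G.AE_summable S_lim_meas main psi by (simp add: term_eq)
qed

end
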